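(* Let $d\ge 1$ and $h\ge 1$ be integers and let $T$ be a $d$-ary tree of height $h$. Then $T$ has a $(\leq 2d(d+1)^{h-1})$-subdivision $S$ with $\phi(S)\le 10$.
   Context: An anagram is a word of the form $WP$ where $W$ is a non-empty word and $P$ is a permutation of $W$. A vertex colouring of a graph is anagram-free if the sequence of colours along every path of the graph is not an anagram. $\phi(G)$ denotes the minimum number of colours in an anagram-free colouring of $G$. A subdivision of $G$ is obtained by replacing each edge $uv$ by a path with endpoints $u,v$; internal vertices of these paths are division vertices. A $(\le k)$-subdivision is a subdivision in which every edge receives at most $k$ division vertices. A $d$-ary tree is a rooted tree in which every vertex has at most $d$ children; its height is the maximum distance from the root to a vertex. *)

theory Defs
  imports "Graph_Theory.Graph_Theory" "HOL-Library.Multiset"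
begin

text \<open>
  Finite simple graphs are symmetric loop-free digraphs without parallel arcs (\<^locale>\<open>pair_graph\<close>):
  an undirected edge \<open>uv\<close> is the pair of arcs \<open>(u, v)\<close> and \<open>(v, u)\<close>.
  Paths are nonempty lists of distinct vertices (\<^const>\<open>vpath\<close>); one vertex is a path.
\<close>

subsection \<open>Anagram-free colourings\<close>

definition anagram :: "'c list \<Rightarrow> bool" where
  "anagram w \<longleftrightarrow> (\<exists>W P. w = W @ P \<and> W \<noteq> [] \<and> mset P = mset W)"

definition anagram_free_colouring :: "('a \<Rightarrow> 'c) \<Rightarrow> 'a pair_pre_digraph \<Rightarrow> bool" where
  "anagram_free_colouring c G \<longleftrightarrow> (\<forall>p. vpath p (with_proj G) \<longrightarrow> \<not> anagram (map c p))"

text \<open>Every finite graph has such a colouring, an injective one, so the minimum is attained.\<close>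

definition anagram_free_chromatic_number :: "'a pair_pre_digraph \<Rightarrow> nat" (\<open>\<phi>\<close>) where
  "\<phi> G = (LEAST k. \<exists>c :: 'a \<Rightarrow> nat. c ` pverts G \<subseteq> {..<k} \<and> anagram_free_colouring c G)"

subsection \<open>Subdivisions\<close>

text \<open>
  The graph \<open>S\<close> arises from \<open>G\<close>, up to renaming the original vertices by \<open>f\<close>, by replacing each edge
  \<open>uv\<close> by the path \<open>P (u, v)\<close>. Both arcs of an edge yield the same path, traversed in opposite
  directions. The division vertices of an edge are those in \<open>inner_vertices (P (u, v))\<close>.
\<close>

definition inner_vertices :: "'a list \<Rightarrow> 'a list" where
  "inner_vertices p = butlast (tl p)"

definition le_subdivision :: "nat \<Rightarrow> 'a pair_pre_digraph \<Rightarrow> 'b pair_pre_digraph \<Rightarrow> bool" where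
  "le_subdivision k G S \<longleftrightarrow> pair_graph G \<and> pair_graph S \<and>
    (\<exists>(f :: 'a \<Rightarrow> 'b) (P :: 'a \<times> 'a \<Rightarrow> 'b list).
      inj_on f (pverts G) \<and>
      (\<forall>(u, v) \<in> parcs G.
        vpath (P (u, v)) (with_proj S) \<and> hd (P (u, v)) = f u \<and> last (P (u, v)) = f v \<and>
        P (v, u) = rev (P (u, v)) \<and>
        set (inner_vertices (P (u, v))) \<inter> f ` pverts G = {} \<and>
        length (inner_vertices (P (u, v))) \<le> k) \<and>
      (\<forall>e \<in> parcs G. \<forall>e' \<in> parcs G. e' \<noteq> e \<and> e' \<noteq> prod.swap e \<longrightarrow>
        set (inner_vertices (P e)) \<inter> set (inner_vertices (P e')) = {}) \<and>
      pverts S = f ` pverts G \<union> (\<Union>e \<in> parcs G. set (inner_vertices (P e))) \<and>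
      parcs S = (\<Union>e \<in> parcs G. set (vwalk_arcs (P e))))"

subsection \<open>Rooted trees\<close>

text \<open>
  The library's \<^const>\<open>tree\<close> does not fit: the two arcs of an undirected edge already form a
  \<^const>\<open>pre_digraph.cycle\<close>. The cycles of an undirected simple graph are those of length at least 3.
\<close>

definition undirected_tree :: "'a pair_pre_digraph \<Rightarrow> bool" where
  "undirected_tree G \<longleftrightarrow> pair_graph G \<and> connected (with_proj G) \<and>
    \<not> (\<exists>p. pre_digraph.cycle (with_proj G) p \<and> 3 \<le> length p)"

text \<open>The children of \<open>v\<close> are the vertices whose path from the root \<open>r\<close> has \<open>v\<close> as penultimate vertex.\<close>

definition children :: "'a pair_pre_digraph \<Rightarrow> 'a \<Rightarrow> 'a \<Rightarrow> 'a set" where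
  "children T r v = {w. \<exists>p. vpath (p @ [v, w]) (with_proj T) \<and> hd (p @ [v, w]) = r}"

definition dary_tree :: "nat \<Rightarrow> 'a pair_pre_digraph \<Rightarrow> 'a \<Rightarrow> bool" where
  "dary_tree d T r \<longleftrightarrow> undirected_tree T \<and> r \<in> pverts T \<and>
    (\<forall>v \<in> pverts T. card (children T r v) \<le> d)"

definition distance :: "'a pair_pre_digraph \<Rightarrow> 'a \<Rightarrow> 'a \<Rightarrow> nat" where
  "distance G u v = (LEAST n. \<exists>p. vwalk p (with_proj G) \<and> hd p = u \<and> last p = v \<and> vwalk_length p = n)"

definition height :: "'a pair_pre_digraph \<Rightarrow> 'a \<Rightarrow> nat" where
  "height T r = Max (distance T r ` pverts T)"

end

theory Submission
  imports Defs "HOL-Library.Countable"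
begin

text \<open>
  An edge from a vertex at depth \<open>t\<close> to its \<open>j\<close>-th child is subdivided into a path with
  \<open>n = j (d + 1)\<^sup>h\<^sup>-\<^sup>1\<^sup>-\<^sup>t\<close> vertices of class 0 followed, going down, by \<open>n\<close> vertices of
  class 1; the original vertices form class 2 and share one colour. Classes 0 and 1 have four colours
  each, and the class-\<open>k\<close> vertices on any path going down from the root spell a factor of Keranen's
  abelian square-free word. So if a path going down were an anagram, each half would contain no vertex
  of class 0 or 1, which is impossible because original vertices are not adjacent. On a path turning
  at \<open>a\<close> into two branches, the numbers of vertices of each class below \<open>a\<close> are numbers in base
  \<open>d + 1\<close> up to a partial last edge, and the two halves cannot agree in all three classes.

  The word is the fixed point of an 85-uniform morphism on \<open>\<int>/4\<close>. An abelian square in it has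
  three cuts; once these cuts are moved to the borders of suitable adjacent blocks, the invertible
  incidence matrix yields a shorter abelian square. That such borders always exist is a finite check.
\<close>

subsection \<open>Keranen's abelian square-free word\<close>

text \<open>The image of the letter 0; the image of \<open>c\<close> is obtained by adding \<open>c\<close> modulo 4.\<close>

definition keranen :: "int list" where
  "keranen =
    [0,1,2,0,2,3,2,1,2,3,2,0,3,2,3,1,3,0,1,0,2,0,1,0,3,1,0,1,2,1,3,1,2,1,0,2,1,2,3,2,0,2,1,0,
     1,3,0,1,0,2,0,3,2,1,2,3,2,0,2,3,1,2,1,0,2,1,2,3,2,0,2,3,2,1,3,2,3,0,3,1,3,2,1,2,0]"

text \<open>
  A cut \<open>(c, l, v, x)\<close> is a position after the first \<open>l\<close> letters of the image of \<open>c\<close>; these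
  letters have total weight \<open>v\<close> modulo 43435 and letter counts \<open>x\<close>.
\<close>

type_synonym vec = "int \<times> int \<times> int \<times> int"
type_synonym cut = "int \<times> int \<times> int \<times> vec"

text \<open>
  The weight of \<open>a\<close> is \<open>t\<^sup>a\<close> for \<open>t = 30176\<close>, which satisfies \<open>t\<^sup>4 = 1\<close> and
  \<open>19 + 21 t + 27 t\<^sup>2 + 18 t\<^sup>3 = 0\<close> modulo \<open>43435 = 5 \<cdot> 7 \<cdot> 17 \<cdot> 73\<close>. Hence the image of every letter
  has weight 0 modulo 43435, the determinant of the incidence matrix.
\<close>

definition weight :: "int \<Rightarrow> int" where
  "weight a = (if a = 0 then 1 else if a = 1 then 30176 else if a = 2 then 19636 else 39101)"

definition shift :: "int \<Rightarrow> int \<Rightarrow> int" where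
  "shift c b = (if c + b < 4 then c + b else c + b - 4)"

fun count_letter :: "int \<Rightarrow> vec \<Rightarrow> vec" where
  "count_letter a (x0, x1, x2, x3) =
    (if a = 0 then (x0 + 1, x1, x2, x3) else if a = 1 then (x0, x1 + 1, x2, x3)
     else if a = 2 then (x0, x1, x2 + 1, x3) else (x0, x1, x2, x3 + 1))"

fun advance :: "int \<Rightarrow> cut \<Rightarrow> cut" where
  "advance b (c, l, v, x) =
    (let a = shift c b; w = v + weight a
     in (c, l + 1, if w < 43435 then w else w - 43435, count_letter a x))"

fun cuts :: "cut list \<Rightarrow> int list \<Rightarrow> cut list list" where
  "cuts r [] = []"
| "cuts r (b # bs) = r # cuts (map (advance b) r) bs"

definition cut_table :: "cut list list" where
  "cut_table = cuts [(0, 0, 0, 0, 0, 0, 0), (1, 0, 0, 0, 0, 0, 0), (2, 0, 0, 0, 0, 0, 0), (3, 0,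
    0, 0, 0, 0, 0)] keranen"

definition image_vec :: "int \<Rightarrow> vec" where
  "image_vec c = (if c = 0 then (19, 21, 27, 18) else if c = 1 then (18, 19, 21, 27)
     else if c = 2 then (27, 18, 19, 21) else (21, 27, 18, 19))"

text \<open>
  A cut seen from the left and from the right border of its block; seen from the right border, the
  offset is negative.
\<close>

fun reps :: "cut \<Rightarrow> (int \<times> int \<times> vec) list" where
  "reps (c, l, v, x0, x1, x2, x3) = (case image_vec c of (y0, y1, y2, y3) \<Rightarrow>
     [(c, l, x0, x1, x2, x3), (c, l - 85, x0 - y0, x1 - y1, x2 - y2, x3 - y3)])"

fun balanced :: "vec \<Rightarrow> vec \<Rightarrow> vec \<Rightarrow> bool" where
  "balanced (x0, x1, x2, x3) (y0, y1, y2, y3) (z0, z1, z2, z3) \<longleftrightarrow>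
     x0 + z0 = y0 + y0 \<and> x1 + z1 = y1 + y1 \<and> x2 + z2 = y2 + y2 \<and> x3 + z3 = y3 + y3"

text \<open>
  Excluded are offsets of three different cuts from one and the same block border: in that case
  cuts on the same side of the border lie in the same block.
\<close>

definition harmless_offsets :: "int \<Rightarrow> int \<Rightarrow> int \<Rightarrow> int \<Rightarrow> int \<Rightarrow> int \<Rightarrow> bool" where
  "harmless_offsets c0 q0 c1 q1 c2 q2 \<longleftrightarrow>
     \<not> (q0 < q1 \<and> q1 < q2 \<and> ((q0 < 0) = (q1 < 0) \<longrightarrow> c0 = c1) \<and> ((q1 < 0) = (q2 < 0) \<longrightarrow> c1 = c2))"

fun harmless :: "int \<times> int \<times> vec \<Rightarrow> int \<times> int \<times> vec \<Rightarrow> int \<times> int \<times> vec \<Rightarrow> bool" where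
  "harmless (c0, q0, x0) (c1, q1, x1) (c2, q2, x2) \<longleftrightarrow>
     balanced x0 x1 x2 \<and> harmless_offsets c0 q0 c1 q1 c2 q2"

definition good :: "cut \<Rightarrow> cut \<Rightarrow> cut \<Rightarrow> bool" where
  "good e0 e1 e2 \<longleftrightarrow>
     list_ex (\<lambda>r0. list_ex (\<lambda>r1. list_ex (\<lambda>r2. harmless r0 r1 r2) (reps e2)) (reps e1)) (reps e0)"

text \<open>\<open>d\<close> is the only weight that the third cut can have once the other two are
  fixed; comparing weights filters the third cuts before the costly test
  \<open>good\<close>.\<close>

fun row_ok :: "cut \<Rightarrow> cut \<Rightarrow> int \<Rightarrow> cut list \<Rightarrow> bool" where
  "row_ok e0 e1 d [] = True"
| "row_ok e0 e1 d ((c, l, v, x) # B) \<longleftrightarrow>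
     (if v = d then good e0 e1 (c, l, v, x) else True) \<and> row_ok e0 e1 d B"

text \<open>\<open>s\<close> is twice the weight of the middle cut, reduced modulo 43435; the
  conditional computes \<open>s - v\<close> modulo 43435.\<close>

fun rows_ok :: "cut \<Rightarrow> int \<Rightarrow> cut list \<Rightarrow> cut list \<Rightarrow> bool" where
  "rows_ok e1 s [] B = True"
| "rows_ok e1 s ((c, l, v, x) # A) B \<longleftrightarrow>
     row_ok (c, l, v, x) e1 (if v \<le> s then s - v else s + 43435 - v) B \<and> rows_ok e1 s A B"

fun tables_ok :: "cut \<Rightarrow> int \<Rightarrow> cut list list \<Rightarrow> cut list list \<Rightarrow> bool" where
  "tables_ok e s (A # As) (B # Bs) \<longleftrightarrow> rows_ok e s A B \<and> tables_ok e s As Bs"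
| "tables_ok e s As Bs = True"

text \<open>
  Since the lengths of the two halves agree, the offsets of the three cuts satisfy
  \<open>l\<^sub>0 + l\<^sub>2 = 2 l\<^sub>1\<close> modulo 85, so only one row of the table has to be tried for the third
  cut. Its index goes down as \<open>l\<^sub>0\<close> goes up, so \<open>R\<close> consists of reversed copies of the table;
  dropping two rows of \<open>R\<close> passes from \<open>l\<^sub>1\<close> to \<open>l\<^sub>1 - 1\<close>.
\<close>

fun all_ok :: "cut list list \<Rightarrow> cut list list \<Rightarrow> cut list list \<Rightarrow> bool" where
  "all_ok [] T R = True"
| "all_ok (((c, l, v, x) # A) # As) T R \<longleftrightarrow>
     tables_ok (c, l, v, x) (if v + v < 43435 then v + v else v + v - 43435) T R
       \<and> all_ok As T (drop 2 R)"
| "all_ok ([] # As) T R \<longleftrightarrow> all_ok As T (drop 2 R)"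

text \<open>Evaluation by rewriting; the weak congruence leaves branches not taken unevaluated. The
  first row of the reversed copies is dropped because middle offset 84 and first offset 0 force the
  third offset 168 mod 85 = 83, the second row of the reversed table.\<close>

lemma all_ok_cut_table:
  "all_ok (rev cut_table) cut_table (tl (rev cut_table @ rev cut_table @ rev cut_table))"
  by (simp only: cut_table_def keranen_def cuts.simps list.map advance.simps weight_def shift_def
      Let_def count_letter.simps image_vec_def reps.simps prod.case balanced.simps harmless.simps
        harmless_offsets_def
      good_def list_ex_Nil_iff list_ex_Cons_iff row_ok.simps rows_ok.simps tables_ok.simps
      all_ok.simps rev.simps append.simps list.sel drop_Suc_Cons drop_0 drop_Nil numeral_2_eq_2
      arith_simps arith_special rel_simps simp_thms if_True if_False add_0_left add_0_right
      Num.inc.simps less_irrefl cong: if_weak_cong)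

section \<open>Meaning of the table entries and exhaustiveness of the check\<close>

definition offset_sum :: "(int \<Rightarrow> int) \<Rightarrow> int \<Rightarrow> nat \<Rightarrow> int" where
  "offset_sum f c l = (\<Sum>k<l. f (shift c (keranen ! k)))"

definition offset_count :: "int \<Rightarrow> int \<Rightarrow> nat \<Rightarrow> int" where
  "offset_count a = offset_sum (\<lambda>x. of_bool (x = a))"

definition cut :: "int \<Rightarrow> nat \<Rightarrow> cut" where
  "cut c l = (c, int l, offset_sum weight c l mod 43435,
     offset_count 0 c l, offset_count 1 c l, offset_count 2 c l, offset_count 3 c l)"

lemma length_keranen: "length keranen = 85"
  by (simp add: keranen_def)

lemma keranen_range: "l < 85 \<Longrightarrow> keranen ! l \<in> {0..3}"
proof -
  assume "l < 85"
  moreover have "\<forall>x \<in> set keranen. x \<in> {0..3}" by (simp add: keranen_def)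
  ultimately show ?thesis using length_keranen by auto
qed

lemma shift_range: "c \<in> {0..3} \<Longrightarrow> b \<in> {0..3} \<Longrightarrow> shift c b \<in> {0..3}"
  by (auto simp: shift_def)

lemma shift_assoc:
  "a \<in> {0..3} \<Longrightarrow> b \<in> {0..3} \<Longrightarrow> c \<in> {0..3} \<Longrightarrow> shift a (shift b c) = shift (shift a b) c"
  by (auto simp: shift_def)

lemma offset_sum_Suc: "offset_sum f c (Suc l) = offset_sum f c l + f (shift c (keranen ! l))"
  by (simp add: offset_sum_def)

lemma add_reduced_mod:
  fixes x y n :: int
  assumes "0 \<le> x" "x < n" "0 \<le> y" "y < n"
  shows "(if x + y < n then x + y else x + y - n) = (x + y) mod n"
  using assms mod_pos_pos_trivial[of "x + y" n] mod_pos_pos_trivial[of "x + y - n" n]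
    minus_mod_self2[of "x + y" n]
  by auto

lemma advance_cut:
  assumes "c \<in> {0..3}" "l < 85"
  shows "advance (keranen ! l) (cut c l) = cut c (Suc l)"
proof -
  define a where "a = shift c (keranen ! l)"
  have "a \<in> {0..3}"
    using shift_range[OF assms(1) keranen_range[OF assms(2)]] by (simp add: a_def)
  then have "a = 0 \<or> a = 1 \<or> a = 2 \<or> a = 3" by auto
  then have count: "count_letter a (offset_count 0 c l, offset_count 1 c l, offset_count 2 c l,
    offset_count 3 c l) =
    (offset_count 0 c (Suc l), offset_count 1 c (Suc l), offset_count 2 c (Suc l),
      offset_count 3 c (Suc l))"
    unfolding offset_count_def offset_sum_Suc a_def[symmetric] by auto
  define v where "v = offset_sum weight c l"
  have "0 \<le> weight a" "weight a < 43435" by (auto simp: weight_def)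
  then have "(if v mod 43435 + weight a < 43435 then v mod 43435 + weight a
      else v mod 43435 + weight a - 43435) = offset_sum weight c (Suc l) mod 43435"
    by (subst add_reduced_mod) (simp_all add: offset_sum_Suc a_def[symmetric] v_def[symmetric]
      mod_simps)
  then show ?thesis
    by (simp only: cut_def advance.simps Let_def a_def[symmetric] v_def[symmetric] count
      of_nat_Suc add.commute)
qed

lemma fold_advance:
  assumes "c \<in> {0..3}" "l \<le> 85"
  shows "fold advance (take l keranen) (c, 0, 0, 0, 0, 0, 0) = cut c l"
  using assms(2)
proof (induction l)
  case 0
  then show ?case by (simp add: cut_def offset_count_def offset_sum_def)
next
  case (Suc l)
  then show ?case
    using advance_cut[OF assms(1), of l] by (simp add: take_Suc_conv_app_nth length_keranen)
qed

lemma length_cuts: "length (cuts r bs) = length bs"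
  by (induction r bs rule: cuts.induct) auto

lemma cuts_nth: "l < length bs \<Longrightarrow> cuts r bs ! l = map (fold advance (take l bs)) r"
  by (induction r bs arbitrary: l rule: cuts.induct) (auto simp: nth_Cons' take_Cons')

lemma length_cut_table: "length cut_table = 85"
  by (simp add: cut_table_def length_cuts length_keranen)

lemma cut_table_nth:
  assumes "l < 85"
  shows "cut_table ! l = [cut 0 l, cut 1 l, cut 2 l, cut 3 l]"
  using assms by (simp add: cut_table_def cuts_nth length_keranen fold_advance)

text \<open>Evaluation of the whole images. The weight 0 is what removes complete blocks from the
  congruences; the counts are the columns of the incidence matrix.\<close>

lemma cut_image:
  assumes "c \<in> {0..3}"
  shows "cut c 85 = (c, 85, 0, image_vec c)"
proof -
  have "fold advance keranen (0, 0, 0, 0, 0, 0, 0) = (0, 85, 0, image_vec 0)"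
    "fold advance keranen (1, 0, 0, 0, 0, 0, 0) = (1, 85, 0, image_vec 1)"
    "fold advance keranen (2, 0, 0, 0, 0, 0, 0) = (2, 85, 0, image_vec 2)"
    "fold advance keranen (3, 0, 0, 0, 0, 0, 0) = (3, 85, 0, image_vec 3)"
    by code_simp+
  moreover have "c \<in> {0, 1, 2, 3}" using assms by auto
  ultimately show ?thesis
    using fold_advance[OF assms, of 85] by (auto simp: length_keranen)
qed

lemma row_okD:
  "row_ok e0 e1 d B \<Longrightarrow> (c, l, v, x) \<in> set B \<Longrightarrow> v = d \<Longrightarrow> good e0 e1 (c, l, v, x)"
  by (induction e0 e1 d B rule: row_ok.induct) (auto split: if_splits)

lemma rows_okD:
  "rows_ok e1 s A B \<Longrightarrow> (c, l, v, x) \<in> set A \<Longrightarrow>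
    row_ok (c, l, v, x) e1 (if v \<le> s then s - v else s + 43435 - v) B"
  by (induction e1 s A B rule: rows_ok.induct) auto

lemma tables_okD:
  "tables_ok e s As Bs \<Longrightarrow> i < length As \<Longrightarrow> i < length Bs \<Longrightarrow> rows_ok e s (As ! i) (Bs ! i)"
  by (induction e s As Bs arbitrary: i rule: tables_ok.induct) (auto simp: nth_Cons')

lemma all_okD:
  "all_ok As T R \<Longrightarrow> j < length As \<Longrightarrow> As ! j = (c, l, v, x) # A \<Longrightarrow>
    tables_ok (c, l, v, x) (if v + v < 43435 then v + v else v + v - 43435) T (drop (2 * j) R)"
proof (induction As T R arbitrary: j rule: all_ok.induct)
  case (2 c' l' v' x' A' As T R)
  then show ?case by (cases j) auto
next
  case (3 As T R)
  then show ?case by (cases j) auto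
qed auto

lemma small_multiple:
  fixes x n :: int
  assumes "x mod n = 0" "\<bar>x\<bar> < 2 * n"
  shows "x \<in> {- n, 0, n}"
proof -
  obtain k where k: "x = n * k" using assms(1) by (auto elim: dvdE simp: mod_eq_0_iff_dvd)
  have "n > 0" using assms(2) by linarith
  have "\<bar>k\<bar> < 2"
  proof (rule ccontr)
    assume "\<not> \<bar>k\<bar> < 2"
    then have "n * 2 \<le> n * \<bar>k\<bar>" using \<open>n > 0\<close> by (intro mult_left_mono) auto
    then show False using assms(2) \<open>n > 0\<close> unfolding k by (simp add: abs_mult)
  qed
  then have "k = -1 \<or> k = 0 \<or> k = 1" by linarith
  then show ?thesis using k by auto
qed

text \<open>The two congruences are what remains of an abelian square when complete blocks are
  discarded. The middle letter is 0 because a constant can be added to the whole word.\<close>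

lemma good_cuts:
  assumes c: "c0 \<in> {0..3}" "c2 \<in> {0..3}" and l: "l0 < 85" "l1 < 85" "l2 < 85"
    and len: "(int l0 + int l2 - 2 * int l1) mod 85 = 0"
    and wt: "(offset_sum weight c0 l0 + offset_sum weight c2 l2 - 2 * offset_sum weight 0 l1) mod
      43435 = 0"
  shows "good (cut c0 l0) (cut 0 l1) (cut c2 l2)"
proof -
  let ?T = cut_table
  define R where "R = tl (rev ?T @ rev ?T @ rev ?T)"
  have lenR: "length R = 254" by (simp add: R_def length_cut_table)
  \<comment> \<open>Two rows of \<open>R\<close> are dropped for each of the \<open>84 - l1\<close>
    entries before middle offset \<open>l1\<close>, and the first offset lies \<open>l0\<close> rows
    further.\<close>
  define m where "m = 2 * (84 - l1) + l0"
  have row0: "?T ! l0 = [cut 0 l0, cut 1 l0, cut 2 l0, cut 3 l0]"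
    and row1: "rev ?T ! (84 - l1) = [cut 0 l1, cut 1 l1, cut 2 l1, cut 3 l1]"
    using l by (simp_all add: cut_table_nth rev_nth length_cut_table)
  have "R ! m = (rev ?T @ rev ?T @ rev ?T) ! Suc m"
    unfolding R_def by (rule nth_tl) (use l in \<open>simp add: length_cut_table m_def\<close>)
  also have "\<dots> = ?T ! l2"
  proof -
    have m: "int m = 168 - 2 * int l1 + int l0"
      using l unfolding m_def by simp
    have "\<bar>int l0 + int l2 - 2 * int l1\<bar> < 2 * 85" using l by linarith
    \<comment> \<open>The three ways in which \<open>l2\<close> can wrap around modulo 85 correspond
      to the three reversed copies of the table.\<close>
    from small_multiple[OF len this]
    consider "int l0 + int l2 - 2 * int l1 = - 85" | "int l0 + int l2 - 2 * int l1 = 0"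
      | "int l0 + int l2 - 2 * int l1 = 85" by blast
    then show ?thesis
    proof cases
      case 1
      then have "m = 83 - l2" "l2 \<le> 83" using m by linarith+
      then show ?thesis using l by (auto simp: nth_append rev_nth length_cut_table)
    next
      case 2
      then have "m = 168 - l2" using m by linarith
      then show ?thesis using l by (auto simp: nth_append rev_nth length_cut_table)
    next
      case 3
      then have "m = 253 - l2" using m by linarith
      then show ?thesis using l by (auto simp: nth_append rev_nth length_cut_table)
    qed
  qed
  finally have row2: "R ! m = [cut 0 l2, cut 1 l2, cut 2 l2, cut 3 l2]"
    using l by (simp add: cut_table_nth)
  define w0 w1 w2 where "w0 = offset_sum weight c0 l0 mod 43435"
    and "w1 = offset_sum weight 0 l1 mod 43435" and "w2 = offset_sum weight c2 l2 mod 43435"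
  define s where "s = (if w1 + w1 < 43435 then w1 + w1 else w1 + w1 - 43435)"
  have "tables_ok (cut 0 l1) s ?T (drop (2 * (84 - l1)) R)"
    using all_okD[OF all_ok_cut_table, of "84 - l1"] row1 l
    by (auto simp: cut_def R_def length_cut_table w1_def s_def simp del: tl_append2)
  then have "rows_ok (cut 0 l1) s (?T ! l0) (drop (2 * (84 - l1)) R ! l0)"
    by (rule tables_okD) (use l in \<open>auto simp: length_cut_table lenR\<close>)
  then have rows: "rows_ok (cut 0 l1) s (?T ! l0) (R ! m)"
    using l by (simp add: lenR m_def)
  have cc: "c0 \<in> {0, 1, 2, 3}" "c2 \<in> {0, 1, 2, 3}" using c by auto
  have "cut c0 l0 \<in> set (?T ! l0)" using cc by (auto simp: row0)
  then have row: "row_ok (cut c0 l0) (cut 0 l1) (if w0 \<le> s then s - w0 else s + 43435 - w0) (R ! m)"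
    unfolding cut_def[of c0] w0_def by (rule rows_okD[OF rows])
  have "cut c2 l2 \<in> set (R ! m)" using cc by (auto simp: row2)
  moreover have "w2 = (if w0 \<le> s then s - w0 else s + 43435 - w0)"
  proof -
    have "(w0 + w2 - 2 * w1) mod 43435 =
      (offset_sum weight c0 l0 + offset_sum weight c2 l2 - 2 * offset_sum weight 0 l1) mod 43435"
      unfolding w0_def w1_def w2_def
        by (intro mod_diff_cong mod_add_cong) (simp_all add: mod_mult_right_eq)
    also note wt
    finally have "(w0 + w2 - 2 * w1) mod 43435 = 0" .
    moreover have w: "0 \<le> w0" "w0 < 43435" "0 \<le> w1" "w1 < 43435" "0 \<le> w2" "w2 < 43435"
      by (simp_all add: w0_def w1_def w2_def)
    then have "\<bar>w0 + w2 - 2 * w1\<bar> < 2 * 43435" by arith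
    ultimately have "w0 + w2 - 2 * w1 \<in> {- 43435, 0, 43435}" by (rule small_multiple)
    then consider "w2 = 2 * w1 - w0 - 43435" | "w2 = 2 * w1 - w0" | "w2 = 2 * w1 - w0 + 43435"
      by force
    then show ?thesis
      by cases (use w in \<open>auto simp: s_def\<close>)
  qed
  ultimately show ?thesis
    unfolding cut_def[of c2] w2_def by (rule row_okD[OF row])
qed

section \<open>Passing from letters to blocks\<close>

text \<open>These are the fixed points of the morphism for every possible first letter, so the class
  is closed under adding a constant modulo 4.\<close>

definition keranen_word :: "(nat \<Rightarrow> int) \<Rightarrow> bool" where
  "keranen_word W \<longleftrightarrow> (\<forall>n. W n \<in> {0..3}) \<and>
     (\<forall>i l. l < 85 \<longrightarrow> W (85 * i + l) = shift (W i) (keranen ! l))"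

definition prefix_sum :: "(int \<Rightarrow> int) \<Rightarrow> (nat \<Rightarrow> int) \<Rightarrow> nat \<Rightarrow> int" where
  "prefix_sum f W n = (\<Sum>k<n. f (W k))"

text \<open>For \<open>p < q < r\<close>, the two factors between these cuts have equal letter
  counts. Quantifying over all \<open>f\<close> yields lengths, weights and counts alike. The cuts
  need no order, since they may coincide after being moved.\<close>

definition abelian_square :: "(nat \<Rightarrow> int) \<Rightarrow> nat \<Rightarrow> nat \<Rightarrow> nat \<Rightarrow> bool" where
  "abelian_square W p q r \<longleftrightarrow> (\<forall>f. prefix_sum f W p + prefix_sum f W r = 2 * prefix_sum f W q)"

lemma prefix_sum_Suc: "prefix_sum f W (Suc n) = prefix_sum f W n + f (W n)"
  by (simp add: prefix_sum_def)

lemma keranen_word_shift: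
  assumes "keranen_word W" "r \<in> {0..3}"
  shows "keranen_word (\<lambda>n. shift r (W n))"
  using assms shift_range shift_assoc keranen_range unfolding keranen_word_def by simp

lemma abelian_square_shift:
  assumes "abelian_square W p q r"
  shows "abelian_square (\<lambda>n. g (W n)) p q r"
proof -
  have "prefix_sum f (\<lambda>n. g (W n)) n = prefix_sum (\<lambda>x. f (g x)) W n" for f n
    by (simp add: prefix_sum_def)
  then show ?thesis using assms by (simp add: abelian_square_def)
qed

text \<open>A complete block with letter \<open>c\<close> contributes the sum of \<open>f\<close>
  over the image of \<open>c\<close>, so sums over positions become sums over block indices.\<close>

lemma prefix_sum_block:
  assumes W: "keranen_word W" and l: "l \<le> 85"
  shows "prefix_sum f W (85 * i + l) =
    prefix_sum (\<lambda>c. offset_sum f c 85) W i + offset_sum f (W i) l"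
proof -
  have step: "prefix_sum f W (85 * i + l) = prefix_sum f W (85 * i) + offset_sum f (W i) l"
    if "l \<le> 85" for i l
    using that
  proof (induction l)
    case (Suc l)
    then show ?case using W by (simp add: prefix_sum_Suc offset_sum_def keranen_word_def)
  qed (simp add: offset_sum_def)
  have "prefix_sum f W (85 * i) = prefix_sum (\<lambda>c. offset_sum f c 85) W i" for i
  proof (induction i)
    case (Suc i)
    have "prefix_sum f W (85 * Suc i) = prefix_sum f W (85 * i + 85)" by (simp add: add.commute)
    then show ?case using step[of 85 i] Suc by (simp add: prefix_sum_Suc)
  qed (simp add: prefix_sum_def)
  then show ?thesis using step[OF l] by simp
qed

lemma prefix_sum_letters:
  assumes "keranen_word W"
  shows "prefix_sum f W n = (\<Sum>a \<in> {0, 1, 2, 3}. f a * prefix_sum (\<lambda>x. of_bool (x = a)) W n)"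
proof (induction n)
  case (Suc n)
  have "W n \<in> {0..3}" using assms unfolding keranen_word_def by blast
  then have "W n = 0 \<or> W n = 1 \<or> W n = 2 \<or> W n = 3" by auto
  then have "f (W n) = (\<Sum>a \<in> {0, 1, 2, 3}. f a * of_bool (W n = a))" by auto
  then have "prefix_sum f W (Suc n) = (\<Sum>a \<in> {0, 1, 2, 3}. f a * prefix_sum (\<lambda>x. of_bool (x
    = a)) W n)
      + (\<Sum>a \<in> {0, 1, 2, 3}. f a * of_bool (W n = a))"
    unfolding prefix_sum_Suc by (rule arg_cong2[where f = "(+)", OF Suc])
  then show ?case by (simp add: prefix_sum_Suc distrib_left)
qed (simp add: prefix_sum_def)

text \<open>The coefficients form the incidence matrix of the morphism, whose determinant 43435 is
  not zero.\<close>

lemma circulant_injective: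
  fixes k0 k1 k2 k3 :: int
  assumes "19 * k0 + 18 * k1 + 27 * k2 + 21 * k3 = 0" "21 * k0 + 19 * k1 + 18 * k2 + 27 * k3 = 0"
    "27 * k0 + 21 * k1 + 19 * k2 + 18 * k3 = 0" "18 * k0 + 27 * k1 + 21 * k2 + 19 * k3 = 0"
  shows "k0 = 0 \<and> k1 = 0 \<and> k2 = 0 \<and> k3 = 0"
  using assms by (intro conjI; linarith)

text \<open>\<open>\<delta>\<close> names the border: 0 for the left one, 1 for the right one, where
  a whole image is subtracted.\<close>

lemma reps_cut:
  assumes "c \<in> {0..3}" "r \<in> set (reps (cut c l))"
  obtains \<delta> :: nat where "\<delta> \<in> {0, 1}"
    "r = (c, int l - 85 * int \<delta>, offset_count 0 c l - int \<delta> * offset_count 0 c 85,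
       offset_count 1 c l - int \<delta> * offset_count 1 c 85,
       offset_count 2 c l - int \<delta> * offset_count 2 c 85,
       offset_count 3 c l - int \<delta> * offset_count 3 c 85)"
proof -
  have v: "image_vec c = (offset_count 0 c 85, offset_count 1 c 85, offset_count 2 c 85,
    offset_count 3 c 85)"
    using cut_image[OF assms(1)] by (simp add: cut_def)
  show ?thesis
    using assms(2) that[of 0] that[of 1] by (auto simp: cut_def v)
qed

lemma good_cutD:
  assumes c: "c0 \<in> {0..3}" "c1 \<in> {0..3}" "c2 \<in> {0..3}"
    and "good (cut c0 l0) (cut c1 l1) (cut c2 l2)"
  obtains d0 d1 d2 :: nat where "d0 \<in> {0, 1}" "d1 \<in> {0, 1}" "d2 \<in> {0, 1}"
    "\<And>a. a \<in> {0, 1, 2, 3} \<Longrightarrow>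
       (offset_count a c0 l0 - int d0 * offset_count a c0 85)
       + (offset_count a c2 l2 - int d2 * offset_count a c2 85)
       = 2 * (offset_count a c1 l1 - int d1 * offset_count a c1 85)"
    "harmless_offsets c0 (int l0 - 85 * int d0) c1 (int l1 - 85 * int d1) c2 (int l2 - 85 * int d2)"
proof -
  obtain r0 r1 r2 where r: "r0 \<in> set (reps (cut c0 l0))" "r1 \<in> set (reps (cut c1 l1))"
    "r2 \<in> set (reps (cut c2 l2))" and hr: "harmless r0 r1 r2"
    using assms(4) unfolding good_def list_ex_iff by blast
  obtain d0 :: nat where d0: "d0 \<in> {0, 1}"
    and r0: "r0 = (c0, int l0 - 85 * int d0, offset_count 0 c0 l0 - int d0 * offset_count 0 c0 85,
       offset_count 1 c0 l0 - int d0 * offset_count 1 c0 85,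
       offset_count 2 c0 l0 - int d0 * offset_count 2 c0 85,
       offset_count 3 c0 l0 - int d0 * offset_count 3 c0 85)"
    by (rule reps_cut[OF c(1) r(1)])
  obtain d1 :: nat where d1: "d1 \<in> {0, 1}"
    and r1: "r1 = (c1, int l1 - 85 * int d1, offset_count 0 c1 l1 - int d1 * offset_count 0 c1 85,
       offset_count 1 c1 l1 - int d1 * offset_count 1 c1 85,
       offset_count 2 c1 l1 - int d1 * offset_count 2 c1 85,
       offset_count 3 c1 l1 - int d1 * offset_count 3 c1 85)"
    by (rule reps_cut[OF c(2) r(2)])
  obtain d2 :: nat where d2: "d2 \<in> {0, 1}"
    and r2: "r2 = (c2, int l2 - 85 * int d2, offset_count 0 c2 l2 - int d2 * offset_count 0 c2 85,
       offset_count 1 c2 l2 - int d2 * offset_count 1 c2 85,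
       offset_count 2 c2 l2 - int d2 * offset_count 2 c2 85,
       offset_count 3 c2 l2 - int d2 * offset_count 3 c2 85)"
    by (rule reps_cut[OF c(3) r(3)])
  have bal: "a \<in> {0, 1, 2, 3} \<Longrightarrow>
       (offset_count a c0 l0 - int d0 * offset_count a c0 85)
       + (offset_count a c2 l2 - int d2 * offset_count a c2 85)
       = 2 * (offset_count a c1 l1 - int d1 * offset_count a c1 85)" for a
    using hr by (auto simp: r0 r1 r2)
  show ?thesis
    by (rule that[OF d0 d1 d2 bal]) (use hr in \<open>simp_all add: r0 r1 r2\<close>)
qed

text \<open>Descent on the right end of the square. The word is generalised too, because each round
  normalises the middle letter anew.\<close>

theorem keranen_word_abelian_square_free:
  assumes "keranen_word W" "p < q" "q < r"
  shows "\<not> abelian_square W p q r"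
  using assms
proof (induction r arbitrary: W p q rule: less_induct)
  case (less p2 W0 p0 p1)
  show ?case
  proof
    assume sq0: "abelian_square W0 p0 p1 p2"
    define i0 i1 i2 where "i0 = p0 div 85" and "i1 = p1 div 85" and "i2 = p2 div 85"
    define l0 l1 l2 where "l0 = p0 mod 85" and "l1 = p1 mod 85" and "l2 = p2 mod 85"
    have p: "p0 = 85 * i0 + l0" "p1 = 85 * i1 + l1" "p2 = 85 * i2 + l2"
      by (auto simp: i0_def i1_def i2_def l0_def l1_def l2_def)
    have l: "l0 < 85" "l1 < 85" "l2 < 85" by (auto simp: l0_def l1_def l2_def)
    \<comment> \<open>\<open>t\<close> is minus the middle letter modulo 4: the check covers only
      middle letter 0.\<close>
    define t where "t = (if W0 i1 = 0 then 0 else 4 - W0 i1)"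
    define W where "W = (\<lambda>n. shift t (W0 n))"
    have W0: "W0 i1 \<in> {0..3}" using less.prems(1) by (auto simp: keranen_word_def)
    then have "t \<in> {0..3}" by (auto simp: t_def)
    then have W: "keranen_word W" unfolding W_def by (rule keranen_word_shift[OF less.prems(1)])
    have sq: "abelian_square W p0 p1 p2"
      unfolding W_def by (rule abelian_square_shift[OF sq0])
    have c1: "W i1 = 0" using W0 by (auto simp: W_def shift_def t_def)
    have rng: "W n \<in> {0..3}" for n using W unfolding keranen_word_def by blast
    have sum: "prefix_sum f W p0 + prefix_sum f W p2 = 2 * prefix_sum f W p1" for f
      using sq unfolding abelian_square_def by blast
    have len_p: "p0 + p2 = 2 * p1" using sum[of "\<lambda>_. 1"] by (simp add: prefix_sum_def)
    have blk: "prefix_sum f W p0 = prefix_sum (\<lambda>c. offset_sum f c 85) W i0 + offset_sum f (W i0) l0"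
      "prefix_sum f W p1 = prefix_sum (\<lambda>c. offset_sum f c 85) W i1 + offset_sum f 0 l1"
      "prefix_sum f W p2 = prefix_sum (\<lambda>c. offset_sum f c 85) W i2 + offset_sum f (W i2) l2" for f
      using prefix_sum_block[OF W] l c1 by (simp_all add: p)
    have "good (cut (W i0) l0) (cut 0 l1) (cut (W i2) l2)"
    proof (rule good_cuts[OF rng rng l])
      show "(int l0 + int l2 - 2 * int l1) mod 85 = 0"
        using len_p unfolding p by presburger
      \<comment> \<open>Complete images have weight 0 modulo 43435, so only the partial blocks
        count.\<close>
      have "43435 dvd offset_sum weight c 85" if "c \<in> {0..3}" for c
        using cut_image[OF that] by (auto simp: cut_def)
      then have dvd: "43435 dvd prefix_sum (\<lambda>c. offset_sum weight c 85) W n" for n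
        unfolding prefix_sum_def using rng by (intro dvd_sum) blast
      have "offset_sum weight (W i0) l0 + offset_sum weight (W i2) l2 - 2 * offset_sum weight 0 l1 =
        2 * prefix_sum (\<lambda>c. offset_sum weight c 85) W i1 - prefix_sum (\<lambda>c. offset_sum weight c 85)
          W i0
        - prefix_sum (\<lambda>c. offset_sum weight c 85) W i2"
        using sum[of weight] unfolding blk by simp
      moreover have "43435 dvd \<dots>" by (intro dvd_diff dvd_mult dvd)
      ultimately show "(offset_sum weight (W i0) l0 + offset_sum weight (W i2) l2
        - 2 * offset_sum weight 0 l1) mod 43435 = 0" by simp
    qed
    then obtain d0 d1 d2 :: nat where d: "d0 \<in> {0, 1}" "d1 \<in> {0, 1}" "d2 \<in> {0, 1}"
      and bal: "\<And>a. a \<in> {0, 1, 2, 3} \<Longrightarrow>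
       (offset_count a (W i0) l0 - int d0 * offset_count a (W i0) 85)
       + (offset_count a (W i2) l2 - int d2 * offset_count a (W i2) 85)
       = 2 * (offset_count a 0 l1 - int d1 * offset_count a 0 85)"
      and harmless: "harmless_offsets (W i0) (int l0 - 85 * int d0) 0 (int l1 - 85 * int d1)
        (W i2) (int l2 - 85 * int d2)"
      by (rule good_cutD[rotated 3]) (use rng in auto)
    define b0 b1 b2 where "b0 = i0 + d0" and "b1 = i1 + d1" and "b2 = i2 + d2"
    have move: "prefix_sum f W (i + d) = prefix_sum f W i + int d * f (W i)" if "d \<in> {0, 1}"
      for f i d
      using that by (auto simp: prefix_sum_Suc)
    define K where "K = (\<lambda>a. prefix_sum (\<lambda>x. of_bool (x = a)) W)"
    \<comment> \<open>\<open>k a\<close> is the imbalance of letter \<open>a\<close> between the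
      factors cut at \<open>b0\<close>, \<open>b1\<close>, \<open>b2\<close>. Balanced offsets force
      the incidence matrix to annihilate it.\<close>
    define k where "k = (\<lambda>a. K a b0 + K a b2 - 2 * K a b1)"
    have letters: "prefix_sum f W n = f 0 * K 0 n + f 1 * K 1 n + f 2 * K 2 n + f 3 * K 3 n" for f n
      by (subst prefix_sum_letters[OF W]) (simp add: K_def)
    have lin: "prefix_sum f W b0 + prefix_sum f W b2 - 2 * prefix_sum f W b1 =
      f 0 * k 0 + f 1 * k 1 + f 2 * k 2 + f 3 * k 3" for f
      unfolding letters k_def by (simp add: algebra_simps)
    have eq: "offset_count a 0 85 * k 0 + offset_count a 1 85 * k 1 + offset_count a 2 85 * k 2
      + offset_count a 3 85 * k 3 = 0" if a: "a \<in> {0, 1, 2, 3}" for a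
    proof -
      let ?f = "\<lambda>c. offset_count a c 85"
      have s: "prefix_sum ?f W i0 + offset_count a (W i0) l0 + (prefix_sum ?f W i2
        + offset_count a (W i2) l2)
        = 2 * (prefix_sum ?f W i1 + offset_count a 0 l1)"
        using sum[of "\<lambda>x. of_bool (x = a)"] unfolding blk by (simp add: offset_count_def)
      have "prefix_sum ?f W b0 + prefix_sum ?f W b2 - 2 * prefix_sum ?f W b1 = 0"
        using s bal[OF a] c1 unfolding b0_def b1_def b2_def move[OF d(1)] move[OF d(2)] move[OF
          d(3)]
        by (simp add: algebra_simps)
      then show ?thesis unfolding lin .
    qed
    have "(offset_count 0 c 85, offset_count 1 c 85, offset_count 2 c 85, offset_count 3 c 85)
      = image_vec c"
      if "c \<in> {0..3}" for c using cut_image[OF that] by (simp add: cut_def)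
    from this[of 0] this[of 1] this[of 2] this[of 3]
    have k: "k 0 = 0 \<and> k 1 = 0 \<and> k 2 = 0 \<and> k 3 = 0"
      using eq[of 0] eq[of 1] eq[of 2] eq[of 3]
      by (intro circulant_injective) (simp_all add: image_vec_def)
    then have sq': "abelian_square W b0 b1 b2"
      using lin unfolding abelian_square_def by simp
    then have len_b: "b0 + b2 = 2 * b1"
      unfolding abelian_square_def by (auto dest: spec[of _ "\<lambda>_. 1"] simp: prefix_sum_def)
    have i: "i0 \<le> i1" "i1 \<le> i2" using less.prems by (auto simp: i0_def i1_def i2_def div_le_mono)
    \<comment> \<open>Cuts in order give a square with smaller right end. Cuts in reverse order are
      impossible, as a move changes an index by at most 1. Three cuts at one border have increasing
      offsets, which \<open>harmless_offsets\<close> excludes.\<close>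
    consider "b0 < b1" | "b0 > b1" | "b0 = b1" by linarith
    then show False
    proof cases
      case 1
      then have "b1 < b2" "b2 < p2" using len_b d p l unfolding b0_def b1_def b2_def by auto
      then show False using less.IH[OF _ W 1] sq' by blast
    next
      case 2
      then show False using len_b d i unfolding b0_def b1_def b2_def by auto
    next
      case 3
      then have "b2 = b1" using len_b by simp
      then show False
        using harmless 3 d p l less.prems(2,3) c1
          unfolding harmless_offsets_def b0_def b1_def b2_def
        by auto
    qed
  qed
qed

section \<open>The infinite word\<close>

text \<open>The fixed point beginning with 0: modulo 4, the letter at \<open>n\<close> is the sum of
  the entries of \<open>keranen\<close> at the base-85 digits of \<open>n\<close>.\<close>

fun keranen_letter :: "nat \<Rightarrow> int" where
  "keranen_letter n = (if n = 0 then 0 else shift (keranen_letter (n div 85)) (keranen ! (n mod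
    85)))"

declare keranen_letter.simps [simp del]

lemma keranen_word_keranen_letter: "keranen_word keranen_letter"
proof -
  have rng: "keranen_letter n \<in> {0..3}" for n
  proof (induction n rule: less_induct)
    case (less n)
    show ?case
    proof (cases "n = 0")
      case True
      then show ?thesis by (simp add: keranen_letter.simps[of 0])
    next
      case False
      then show ?thesis
        using shift_range[OF less[of "n div 85"] keranen_range[of "n mod 85"]]
        by (simp add: keranen_letter.simps[of n] del: atLeastAtMost_iff)
    qed
  qed
  moreover have "keranen_letter (85 * i + l) = shift (keranen_letter i) (keranen ! l)"
    if "l < 85" for i l
  proof (cases "i = 0 \<and> l = 0")
    case True
    then show ?thesis by (simp add: keranen_letter.simps shift_def keranen_def)
  next
    case False
    then have "85 * i + l \<noteq> 0" by auto
    then show ?thesis using that by (subst keranen_letter.simps) auto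
  qed
  ultimately show ?thesis by (simp add: keranen_word_def)
qed

lemma keranen_letter_abelian_square_free:
  assumes "p < q" "q < r"
  shows "mset (map keranen_letter [p..<q]) \<noteq> mset (map keranen_letter [q..<r])"
proof
  assume eq: "mset (map keranen_letter [p..<q]) = mset (map keranen_letter [q..<r])"
  have "prefix_sum f keranen_letter p + prefix_sum f keranen_letter r
    = 2 * prefix_sum f keranen_letter q" for f
  proof -
    have "prefix_sum f keranen_letter n = prefix_sum f keranen_letter m
        + sum_mset (image_mset f (mset (map keranen_letter [m..<n])))" if "m \<le> n" for m n
    proof -
      have "sum_mset (image_mset f (mset (map keranen_letter [m..<n])))
        = (\<Sum>k = m..<n. f (keranen_letter k))"
        by (simp add: sum_unfold_sum_mset image_mset.compositionality o_def)
      moreover have "prefix_sum f keranen_letter n = prefix_sum f keranen_letter m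
        + (\<Sum>k = m..<n. f (keranen_letter k))"
        using that unfolding prefix_sum_def lessThan_atLeast0
          by (simp add: sum.atLeastLessThan_concat)
      ultimately show ?thesis by simp
    qed
    from this[of p q] this[of q r] show ?thesis using assms eq by simp
  qed
  then show False
    using keranen_word_abelian_square_free[OF keranen_word_keranen_letter assms]
    by (simp add: abelian_square_def)
qed

definition letter :: "nat \<Rightarrow> nat" where
  "letter n = nat (keranen_letter n)"

lemma keranen_letter_range: "keranen_letter n \<in> {0..3}"
  using keranen_word_keranen_letter unfolding keranen_word_def by blast

lemma letter_less: "letter n < 4"
  using keranen_letter_range[of n] by (simp add: letter_def) linarith

lemma letter_abelian_square_free:
  assumes "p < q" "q < r"
  shows "mset (map letter [p..<q]) \<noteq> mset (map letter [q..<r])"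
proof
  assume "mset (map letter [p..<q]) = mset (map letter [q..<r])"
  then have "mset (map int (map letter [p..<q])) = mset (map int (map letter [q..<r]))"
    by (metis mset_map)
  moreover have "map int (map letter xs) = map keranen_letter xs" for xs
    using keranen_letter_range by (simp add: letter_def)
  ultimately show False using keranen_letter_abelian_square_free[OF assms] by metis
qed

subsection \<open>Colouring the vertices of the subdivision\<close>

text \<open>
  A vertex of the tree is addressed by the list of child indices on the way from it up to the root, so
  its parent has address \<^const>\<open>tl\<close>. The pair \<open>(c, i)\<close> is the vertex \<open>i\<close> steps above the tree vertex
  \<open>c\<close> on the subdivided edge towards the parent of \<open>c\<close>, which contains \<open>2 * half c\<close> division vertices.
\<close>

locale address =
  fixes d h :: nat
begin

fun half :: "nat list \<Rightarrow> nat" where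
  "half [] = 0"
| "half (j # c) = j * (d + 1) ^ (h - Suc (length c))"

text \<open>For a valid address, this counts the class-0 vertices, and equally the class-1 vertices,
  from the root to the tree vertex \<open>c\<close>. Its digits in base \<open>d + 1\<close> are the
  child indices.\<close>

fun total :: "nat list \<Rightarrow> nat" where
  "total [] = 0"
| "total (j # c) = total c + half (j # c)"

definition valid :: "nat list \<times> nat \<Rightarrow> bool" where
  "valid s \<longleftrightarrow> length (fst s) \<le> h \<and> set (fst s) \<subseteq> {1..d} \<and> snd s \<le> 2 * half (fst s)"

fun up :: "nat list \<times> nat \<Rightarrow> nat list \<times> nat" where
  "up (c, i) = (if i < 2 * half c then (c, Suc i) else (tl c, 0))"

definition kind :: "nat list \<times> nat \<Rightarrow> nat" where
  "kind s = (if snd s = 0 then 2 else if snd s \<le> half (fst s) then 1 else 0)"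

text \<open>The number of vertices of class \<open>k\<close> from the root down to \<open>s\<close>, inclusive.\<close>

definition cnt :: "nat \<Rightarrow> nat list \<times> nat \<Rightarrow> nat" where
  "cnt k s = (let (c, i) = s in
     if k = 0 then total c - (i - 1 - half c) else if k = 1 then total c - min (half c) (i - 1)
     else length c + of_bool (i = 0))"

text \<open>Division by 4 recovers the class, so equal colour multisets agree class by
  class.\<close>

definition colour :: "nat list \<times> nat \<Rightarrow> nat" where
  "colour s = (if kind s = 2 then 8 else 4 * kind s + letter (cnt (kind s) s))"

text \<open>The root is excluded as a child because \<open>up\<close> maps it to itself.\<close>

definition child_of :: "nat list \<times> nat \<Rightarrow> nat list \<times> nat \<Rightarrow> bool" where
  "child_of t s \<longleftrightarrow> valid s \<and> fst s \<noteq> [] \<and> up s = t"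

abbreviation descending :: "(nat list \<times> nat) list \<Rightarrow> bool" where
  "descending \<equiv> successively child_of"

section \<open>Paths going down from the root\<close>

text \<open>Child indices start at 1, so every edge is really subdivided.\<close>

lemma half_pos: "valid s \<Longrightarrow> fst s \<noteq> [] \<Longrightarrow> 0 < half (fst s)"
  by (cases "fst s") (auto simp: valid_def)

lemma half_le_total: "half c \<le> total c"
  by (cases c) auto

lemma kind_cases: "kind s = 0 \<or> kind s = 1 \<or> kind s = 2"
  by (auto simp: kind_def)

lemma kind_colour: "kind s = colour s div 4"
  using kind_cases[of s] letter_less[of "cnt (kind s) s"] by (auto simp: colour_def)

text \<open>In \<open>cnt\<close>, the amount subtracted from \<open>total c\<close> is the number
  of vertices of the class on the same edge strictly below \<open>s\<close>; truncation makes it 0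
  when there are none.\<close>

lemma cnt_child:
  assumes "child_of t s" "k < 3"
  shows "cnt k s = cnt k t + of_bool (kind s = k)"
proof -
  obtain c i where s: "s = (c, i)" by fastforce
  then have t: "t = up (c, i)" and c: "c \<noteq> []" and i: "i \<le> 2 * half c" and n: "0 < half c"
    using assms(1) half_pos[of s] by (auto simp: child_of_def valid_def)
  obtain j c' where c': "c = j # c'" using c by (cases c) auto
  have le: "half c \<le> total c" by (rule half_le_total)
  have tot: "total c = total c' + half c" using c' by simp
  consider "k = 0" | "k = 1" | "k = 2" using assms(2) by linarith
  then show ?thesis
  proof cases
    case 1
    then show ?thesis using n i le tot c' unfolding s t cnt_def kind_def up.simps
      by (cases "i < 2 * half c") (auto simp del: half.simps total.simps)
  next
    case 2
    then show ?thesis using n i le tot c' unfolding s t cnt_def kind_def up.simps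
      by (cases "i < 2 * half c") (auto simp: min_def simp del: half.simps total.simps)
  next
    case 3
    then show ?thesis using n i c' unfolding s t cnt_def kind_def up.simps
      by (cases "i < 2 * half c") (auto simp del: half.simps)
  qed
qed

lemma descending_cnt:
  assumes "descending (a # ys)" "k < 3"
  shows "cnt k (last (a # ys)) = cnt k a + length (filter (\<lambda>s. kind s = k) ys)"
  using assms(1)
proof (induction ys arbitrary: a)
  case (Cons y ys)
  then have "child_of a y" "descending (y # ys)" by auto
  then show ?case using Cons.IH[of y] cnt_child[OF _ assms(2), of a y] by simp
qed simp

text \<open>The indices are consecutive, so the class-\<open>k\<close> vertices spell a factor of
  the word. It starts at \<open>cnt k y\<close> if \<open>y\<close> has class \<open>k\<close>, and
  one later otherwise.\<close>

lemma descending_cnt_list: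
  assumes "descending (y # ys)" "k < 3"
  shows "map (cnt k) (filter (\<lambda>s. kind s = k) (y # ys)) =
    [Suc (cnt k y) - of_bool (kind y = k)..<Suc (cnt k (last (y # ys)))]"
  using assms(1)
proof (induction ys arbitrary: y)
  case Nil
  then show ?case by simp
next
  case (Cons z zs)
  then have z: "child_of y z" "descending (z # zs)" by auto
  have "cnt k y \<le> cnt k (last (y # z # zs))"
    using descending_cnt[OF Cons.prems assms(2)] by simp
  moreover have "map (cnt k) (filter (\<lambda>s. kind s = k) (z # zs))
    = [Suc (cnt k y)..<Suc (cnt k (last (z # zs)))]"
    using Cons.IH[OF z(2)] cnt_child[OF z(1) assms(2)] by (simp split: if_splits)
  ultimately show ?case by (auto simp: upt_conv_Cons)
qed

lemma mset_colour_kind: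
  assumes "mset (map colour us) = mset (map colour vs)"
  shows "mset (map colour (filter (\<lambda>s. kind s = k) us)) = mset (map colour (filter (\<lambda>s. kind s
    = k) vs))"
proof -
  have "mset (map colour (filter (\<lambda>s. kind s = k) us)) = filter_mset (\<lambda>x. x div 4
    = k) (mset (map colour us))" for us
    by (induction us) (auto simp: kind_colour)
  then show ?thesis using assms by simp
qed

lemma anagram_mapE:
  assumes "anagram (map f ys)"
  obtains us vs where "ys = us @ vs" "us \<noteq> []" "mset (map f us) = mset (map f vs)"
proof -
  obtain W P where w: "map f ys = W @ P" "W \<noteq> []" "mset P = mset W"
    using assms unfolding anagram_def by blast
  obtain us vs where "ys = us @ vs" "map f us = W" "map f vs = P"
    using w(1) unfolding map_eq_append_conv by blast
  then show thesis using w by (intro that[of us vs]) auto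
qed

lemma descending_not_anagram:
  assumes "descending ys"
  shows "\<not> anagram (map colour ys)"
proof
  assume "anagram (map colour ys)"
  then obtain us vs where ys: "ys = us @ vs" and us: "us \<noteq> []"
    and eq: "mset (map colour us) = mset (map colour vs)"
    by (rule anagram_mapE)
  \<comment> \<open>If one half has a vertex of class \<open>k\<close>, both have equally many.
    Their indices form two adjacent intervals, giving an abelian square.\<close>
  have empty: "filter (\<lambda>s. kind s = k) us = [] \<and> filter (\<lambda>s. kind s = k) vs = []" if k:
    "k < 2" for k
  proof (rule ccontr)
    define U V where "U = filter (\<lambda>s. kind s = k) us" and "V = filter (\<lambda>s. kind s = k) vs"
    assume ne: "\<not> (filter (\<lambda>s. kind s = k) us = [] \<and> filter (\<lambda>s. kind s = k) vs = [])"
    have UV: "mset (map colour U) = mset (map colour V)"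
      unfolding U_def V_def by (rule mset_colour_kind[OF eq])
    then have len: "length U = length V" by (metis length_map size_mset)
    with ne have U: "0 < length U" by (auto simp: U_def V_def)
    have "ys \<noteq> []" using us ys by simp
    then obtain y ys' where y: "ys = y # ys'" by (meson neq_Nil_conv)
    have "descending (y # ys')" using assms unfolding y .
    moreover have "k < 3" using k by simp
    ultimately obtain p r where "map (cnt k) (filter (\<lambda>s. kind s = k) ys) = [p..<r]"
      unfolding y using descending_cnt_list by blast
    then have pr: "map (cnt k) (U @ V) = [p..<r]" unfolding U_def V_def ys by simp
    define q where "q = p + length U"
    have "length [p..<r] = length U + length V" unfolding pr[symmetric] by simp
    then have "r - p = length U + length V" by simp
    then have r: "r = q + length V" "p < q" "q < r" using U len unfolding q_def by linarith+
    have "[p..<r] = [p..<q] @ [q..<r]"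
      using upt_add_eq_append[of p q "length V"] r by simp
    then have "map (cnt k) U @ map (cnt k) V = [p..<q] @ [q..<r]" using pr by simp
    moreover have "length (map (cnt k) U) = length [p..<q]" by (simp add: q_def)
    ultimately have "map (cnt k) U = [p..<q]" "map (cnt k) V = [q..<r]"
      using append_eq_append_conv by blast+
    moreover have "map colour U = map (\<lambda>n. 4 * k + n) (map letter (map (cnt k) U))"
      "map colour V = map (\<lambda>n. 4 * k + n) (map letter (map (cnt k) V))"
      using k by (auto simp: U_def V_def colour_def)
    ultimately have "mset (map (\<lambda>n. 4 * k + n) (map letter [p..<q])) = mset (map (\<lambda>n. 4 * k
      + n) (map letter [q..<r]))"
      using UV by (simp only:)
    then have "image_mset (\<lambda>n. 4 * k + n) (mset (map letter [p..<q])) = image_mset (\<lambda>n. 4 * k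
      + n) (mset (map letter [q..<r]))"
      by (simp only: mset_map)
    then have "image_mset (\<lambda>n. n - 4 * k) (image_mset (\<lambda>n. 4 * k + n) (mset (map letter [p..<q]))) =
        image_mset (\<lambda>n. n - 4 * k) (image_mset (\<lambda>n. 4 * k + n) (mset (map letter [q..<r])))"
      by (rule arg_cong)
    moreover have "image_mset (\<lambda>n. n - 4 * k) (image_mset (\<lambda>n. 4 * k + n) M) = M" for M
      by (induction M) auto
    ultimately have "mset (map letter [p..<q]) = mset (map letter [q..<r])" by (simp only:)
    then show False using letter_abelian_square_free r by blast
  qed
  have red: "kind s = 2" if "s \<in> set ys" for s
    using kind_cases[of s] empty[of 0] empty[of 1] that by (auto simp: ys filter_empty_conv)
  have "length us = length vs" using eq by (metis length_map size_mset)
  moreover have "0 < length us" using us by simp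
  ultimately have "2 \<le> length ys" unfolding ys length_append by linarith
  then obtain y z zs where y: "ys = y # z # zs" by (cases ys; cases "tl ys") auto
  then have "child_of y z" "kind y = 2" "kind z = 2" using assms red by auto
  then show False using half_pos[of z]
    by (cases z) (auto simp: child_of_def kind_def split: if_splits)
qed

section \<open>Bounds in base \<open>d + 1\<close> and paths with a turn\<close>

text \<open>Further digits, each at most \<open>d\<close>, add less than one unit of the last digit
  of \<open>c\<close>. The power on the left is the slack that carries the induction.\<close>

lemma total_bound:
  assumes "set (t @ c) \<subseteq> {1..d}" "length (t @ c) \<le> h"
  shows "total (t @ c) + (d + 1) ^ (h - length (t @ c)) \<le> total c + (d + 1) ^ (h - length c)"
  using assms
proof (induction t)
  case (Cons j t)
  define e where "e = h - Suc (length (t @ c))"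
  have e: "h - length (t @ c) = Suc e" using Cons.prems by (simp add: e_def)
  have "j + 1 \<le> d + 1" using Cons.prems by simp
  then have "(j + 1) * (d + 1) ^ e \<le> (d + 1) * (d + 1) ^ e" by (rule mult_right_mono) simp
  then have "total ((j # t) @ c) + (d + 1) ^ (h - length ((j # t) @ c)) \<le> total (t @ c) + (d
    + 1) ^ (h - length (t @ c))"
    unfolding e by (simp add: e_def)
  then show ?case using Cons by simp
qed simp

lemma total_append: "total c \<le> total (t @ c)"
  by (induction t) (auto intro: trans_le_add1)

lemma cnt_ge: "valid (j # c, i) \<Longrightarrow> k < 2 \<Longrightarrow> total c \<le> cnt k (j # c, i)"
  by (auto simp: cnt_def valid_def)

lemma cnt_le: "k < 2 \<Longrightarrow> cnt k (c, i) \<le> total c"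
  by (auto simp: cnt_def)

text \<open>Here \<open>c\<close> is the turning vertex, \<open>j\<close> the branch and
  \<open>u\<close> the unit of its digit; later digits add less than \<open>u\<close>. On the first
  edge class 0 precedes class 1, so having met class 1 means that all \<open>j * u\<close> class-0
  vertices are passed; having met another original vertex means the same for class 1.\<close>

lemma branch_bounds:
  assumes s: "valid s" "fst s = t @ j # c"
  defines "u \<equiv> (d + 1) ^ (h - Suc (length c))"
  shows "k < 2 \<Longrightarrow> cnt k s < total c + (j + 1) * u"
    and "total c < cnt 1 s \<Longrightarrow> total c + j * u \<le> cnt 0 s"
    and "Suc (length c) < cnt 2 s \<Longrightarrow> total c + j * u \<le> cnt 1 s"
proof -
  obtain c' i where c': "s = (c', i)" by fastforce
  with s have c'': "c' = t @ j # c" by simp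
  have tot: "total (j # c) = total c + j * u" by (simp add: u_def)
  have "total c' + (d + 1) ^ (h - length c') \<le> total (j # c) + (d + 1) ^ (h - length (j # c))"
    using total_bound[of t "j # c"] s by (simp add: valid_def c' c'')
  moreover have "0 < (d + 1) ^ (h - length c')" "(d + 1) ^ (h - length (j # c)) = u"
    by (simp_all add: u_def)
  moreover have "(j + 1) * u = j * u + u" by simp
  ultimately have "total c' < total c + (j + 1) * u"
    unfolding tot by linarith
  then show "k < 2 \<Longrightarrow> cnt k s < total c + (j + 1) * u"
    using cnt_le[of k c' i] c' by simp
  have deep: "total c + j * u \<le> cnt k s" if ne: "t \<noteq> []" and k: "k < 2" for k
  proof -
    obtain j' t' where t: "t = j' # t'" using ne by (cases t) auto
    have "total (j # c) \<le> total (t' @ j # c)" by (rule total_append)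
    also have "\<dots> \<le> cnt k s" using cnt_ge[of j' "t' @ j # c" i k] s(1) k by (simp add: c' c'' t)
    finally show ?thesis unfolding tot .
  qed
  show "total c + j * u \<le> cnt 0 s" if "total c < cnt 1 s"
  proof (cases "t = []")
    case True
    then have c'_total: "total c' = total c + half c'" "total c' = total c + j * u"
      using tot by (simp_all add: c'')
    have "cnt 1 s = total c' - min (half c') (i - 1)" by (simp add: cnt_def c')
    then have "i - 1 < half c'" using that c'_total(1) by (simp add: min_def split: if_splits)
    then have "cnt 0 s = total c'" by (simp add: cnt_def c')
    then show ?thesis using c'_total(2) by simp
  qed (simp add: deep)
  show "total c + j * u \<le> cnt 1 s" if "Suc (length c) < cnt 2 s"
  proof (cases "t = []")
    case True
    then have "length c' = Suc (length c)" "total c' = total c + j * u"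
      using tot by (simp_all add: c'')
    moreover have "i = 0" using that \<open>length c' = Suc (length c)\<close>
      by (auto simp: cnt_def c' split: if_splits)
    ultimately show ?thesis by (simp add: cnt_def c')
  qed (simp add: deep)
qed

lemma descending_branch:
  assumes "descending (y # ys)" "fst y = t @ c"
  shows "\<exists>t. fst (last (y # ys)) = t @ c"
  using assms
proof (induction ys arbitrary: y t)
  case (Cons z zs)
  then have z: "child_of y z" "descending (z # zs)" by auto
  have "\<exists>t. fst z = t @ c"
  proof (cases z)
    case (Pair c' i)
    then obtain j where "fst y = c' \<or> c' = j # fst y"
      using z(1) by (cases c') (auto simp: child_of_def split: if_splits)
    then show ?thesis using Cons.prems(2) Pair by (metis append_Cons fst_conv)
  qed
  then show ?case using Cons.IH[OF z(2)] by auto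
qed simp

text \<open>Inside an edge the next vertex down is determined, so only an original vertex has two
  children.\<close>

lemma two_children:
  assumes "child_of a x" "child_of a y" "x \<noteq> y"
  obtains c i j where "a = (c, 0)" "fst x = i # c" "fst y = j # c" "i \<noteq> j"
proof -
  obtain c1 i1 c2 i2 where xy: "x = (c1, i1)" "y = (c2, i2)" by fastforce
  obtain j1 c1' j2 c2' where c: "c1 = j1 # c1'" "c2 = j2 # c2'"
    using assms(1,2) xy by (cases c1; cases c2) (auto simp: child_of_def)
  have "i1 \<le> 2 * half c1" "i2 \<le> 2 * half c2" using assms(1,2) xy
    by (auto simp: child_of_def valid_def)
  then show ?thesis
    using assms that[of c1' j1 j2] unfolding child_of_def xy c
    by (auto simp del: half.simps split: if_splits)
qed

lemma descending_valid:
  "descending (a # ys) \<Longrightarrow> ys \<noteq> [] \<Longrightarrow> valid (last ys) \<and> fst (last ys) \<noteq> []"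
  by (induction ys arbitrary: a) (auto simp: child_of_def)

text \<open>
  Let \<open>x\<close>, \<open>m\<close> and \<open>y\<close> be the last vertices of \<open>xs\<close>, \<open>ms\<close> and \<open>vs\<close>, and count the vertices of each
  class below \<open>a\<close>. Class 2 forces \<open>y\<close> to lie beyond the first edge of its branch, then class 0 forces
  \<open>m\<close> to lie in the upper half of that edge. Hence \<open>x\<close> and \<open>y\<close> have the same class-1 count, so the
  branch of \<open>x\<close> has the larger index, and then class 0 is too large at \<open>x\<close>.
\<close>

lemma branching_kind_counts:
  assumes xs: "descending (a # xs)" "xs \<noteq> []" and ys: "descending (a # ms @ vs)" "vs \<noteq> []"
    and ne: "hd xs \<noteq> hd (ms @ vs)"
    and eq: "\<And>k. k < 3 \<Longrightarrow> length (filter (\<lambda>s. kind s = k) (rev xs @ a # ms))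
      = length (filter (\<lambda>s. kind s = k) vs)"
  shows False
proof -
  obtain x0 xs' where x0: "xs = x0 # xs'" using xs(2) by (cases xs) auto
  obtain y0 ys' where y0: "ms @ vs = y0 # ys'" using ys(2) by (cases "ms @ vs") auto
  have "child_of a x0" "child_of a y0" "x0 \<noteq> y0" using xs ys ne unfolding x0 y0 by auto
  then obtain c i j where a: "a = (c, 0)" and ij: "fst x0 = i # c" "fst y0 = j # c" "i \<noteq> j"
    by (rule two_children)
  define u where "u = (d + 1) ^ (h - Suc (length c))"
  define x m y where "x = last xs" and "m = last (a # ms)" and "y = last vs"
  have X: "cnt k x = cnt k a + length (filter (\<lambda>s. kind s = k) xs)" if "k < 3" for k
    using descending_cnt[OF xs(1) that] xs(2) by (simp add: x_def)
  have dm: "descending (a # ms)" using ys(1) by (metis append_Cons successively_append_iff)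
  have M: "cnt k m = cnt k a + length (filter (\<lambda>s. kind s = k) ms)" if "k < 3" for k
    using descending_cnt[OF dm that] by (simp add: m_def)
  have Y: "cnt k y = cnt k m + length (filter (\<lambda>s. kind s = k) vs)" if "k < 3" for k
    using descending_cnt[OF ys(1) that] M[OF that] ys(2) by (simp add: y_def)
  \<comment> \<open>The first half consists of \<open>xs\<close>, \<open>a\<close> and
    \<open>ms\<close>; the count of \<open>vs\<close> is the one at \<open>y\<close> minus the one
    at \<open>m\<close>, hence the factor 2.\<close>
  have bal: "(cnt k x - cnt k a) + of_bool (kind a = k) + 2 * (cnt k m - cnt k a)
    = cnt k y - cnt k a" if "k < 3" for k
    using X[OF that] M[OF that] Y[OF that] eq[OF that] by (simp flip: rev_filter split: if_splits)
  have ka: "kind a = 2" by (simp add: a kind_def)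
  have ca: "cnt 0 a = total c" "cnt 1 a = total c" "cnt 2 a = Suc (length c)"
    by (auto simp: a cnt_def)
  have vx: "valid x" using descending_valid[OF xs] by (simp add: x_def)
  have vy: "valid y" using descending_valid[OF ys(1)] ys(2) by (simp add: y_def)
  obtain tx where tx: "fst x = tx @ i # c"
    using descending_branch[of x0 xs' "[]" "i # c"] xs(1) ij(1) by (auto simp: x_def x0)
  have "descending (y0 # ys')" using ys(1) unfolding y0 by simp
  moreover have "last (y0 # ys') = y" using ys(2) unfolding y0[symmetric] y_def by simp
  ultimately obtain ty where ty: "fst y = ty @ j # c"
    using descending_branch[of y0 ys' "[]" "j # c"] ij(2) by auto
  note bx = branch_bounds[OF vx tx, folded u_def] and by' = branch_bounds[OF vy ty, folded u_def]
  have j: "1 \<le> j" using vy by (simp add: valid_def ty)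
  have u: "1 \<le> u" by (simp add: u_def)
  have ge: "cnt k a \<le> cnt k x" "cnt k a \<le> cnt k m" "cnt k m \<le> cnt k y" if "k < 3" for k
    using X[OF that] M[OF that] Y[OF that] by auto
  have "Suc (length c) < cnt 2 y" using bal[of 2] ka ca by simp
  then have y1: "total c + j * u \<le> cnt 1 y" by (rule by'(3))
  have y0': "cnt 0 y < total c + (j + 1) * u" by (rule by'(1)) simp
  \<comment> \<open>A class-1 vertex in \<open>ms\<close> would put \<open>j * u\<close> class-0
    vertices into the first half and as many into the second, but \<open>y\<close> has fewer than
    \<open>(j + 1) * u\<close> of them below \<open>a\<close>.\<close>
  have m1: "cnt 1 m = total c"
  proof (rule ccontr)
    assume "cnt 1 m \<noteq> total c"
    then have gt: "total c < cnt 1 m" using ge(2)[of 1] ca by simp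
    then have "ms \<noteq> []" using ca by (auto simp: m_def)
    then have "descending (a # ms)" "ms \<noteq> []" "hd ms = y0" using dm y0 by (cases ms; simp)+
    then obtain t where "fst m = t @ j # c"
      using descending_branch[of y0 "tl ms" "[]" "j # c"] ij(2) by (cases ms) (auto simp: m_def)
    moreover have "valid m" using descending_valid[OF dm \<open>ms \<noteq> []\<close>] \<open>ms \<noteq> []\<close> by (simp add: m_def)
    ultimately have "total c + j * u \<le> cnt 0 m" using branch_bounds(2)[of m t j c] gt
      by (simp add: u_def)
    then have "2 * (j * u) \<le> cnt 0 y - total c" using bal[of 0] ca by simp
    moreover have "u \<le> j * u" "(j + 1) * u = j * u + u" using j by simp_all
    ultimately show False using y0' u by linarith
  qed
  then have x1: "cnt 1 x = cnt 1 y" using bal[of 1] ge[of 1] ka ca by simp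
  have "0 < j * u" using j u by simp
  then have "total c < cnt 1 x" using x1 y1 by linarith
  \<comment> \<open>Class 0 yields \<open>i < j\<close>. Then the class-1 count in branch
    \<open>i\<close> stays below \<open>total c + j * u\<close>, which \<open>y\<close> has
    reached.\<close>
  then have "total c + i * u \<le> cnt 0 x" by (rule bx(2))
  also have "\<dots> \<le> cnt 0 y" using bal[of 0] ge(1)[of 0] ge(2)[of 0] ge(3)[of 0] ca by simp
  also have "\<dots> < total c + (j + 1) * u" by (rule y0')
  finally have "i * u < (j + 1) * u" by simp
  then have "i < j + 1" by (simp only: mult_less_cancel2)
  then have "i < j" using ij(3) by simp
  then have "(i + 1) * u \<le> j * u" by (intro mult_right_mono) auto
  moreover have "cnt 1 x < total c + (i + 1) * u" by (rule bx(1)) simp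
  ultimately show False using x1 y1 by simp
qed

text \<open>Parents are unique, so a path that steps down to a vertex cannot go up from it without
  repeating the parent; hence it turns at most once.\<close>

lemma tree_path_decomp:
  assumes "p \<noteq> []" "distinct p" "successively (\<lambda>s t. child_of s t \<or> child_of t s) p"
  shows "\<exists>a xs ys. p = rev xs @ a # ys \<and> descending (a # xs) \<and> descending (a # ys)"
  using assms
proof (induction p)
  case (Cons x p)
  show ?case
  proof (cases p)
    case Nil
    then show ?thesis by (intro exI[of _ x] exI[of _ "[]"]) simp
  next
    case (Cons y q)
    then obtain a xs ys where p: "p = rev xs @ a # ys" "descending (a # xs)" "descending (a # ys)"
      using Cons.IH Cons.prems by auto
    have xy: "child_of x y \<or> child_of y x" using Cons.prems(3) Cons by simp
    show ?thesis
    proof (cases xs rule: rev_cases)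
      case Nil
      then have "y = a" using p Cons by simp
      from xy show ?thesis
      proof
        assume "child_of x y"
        then have "x # p = rev [] @ x # a # ys" "descending [x]" "descending (x # a # ys)"
          using p Nil \<open>y = a\<close> by auto
        then show ?thesis by blast
      next
        assume "child_of y x"
        then have "x # p = rev [x] @ a # ys" "descending [a, x]" using p Nil \<open>y = a\<close> by auto
        then show ?thesis using p by blast
      qed
    next
      case (snoc xs' y')
      then have y': "y' = y" using p Cons by simp
      have "\<not> child_of x y"
      proof
        assume "child_of x y"
        moreover have "child_of (last (a # xs')) y"
          using p(2) snoc y' by (auto simp: successively_append_iff simp flip: append_Cons)
        ultimately have "x = last (a # xs')" by (simp add: child_of_def)
        then have "x \<in> set p" using p(1) snoc by (auto split: if_splits)
        then show False using Cons.prems(2) by simp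
      qed
      with xy have "child_of y x" by blast
      then have "descending (a # xs @ [x])"
        using p(2) snoc y' by (auto simp: successively_append_iff simp flip: append_Cons)
      moreover have "x # p = rev (xs @ [x]) @ a # ys" using p by simp
      ultimately show ?thesis using p(3) by blast
    qed
  qed
qed simp

lemma length_filter_kind:
  assumes "mset (map colour us) = mset (map colour vs)"
  shows "length (filter (\<lambda>s. kind s = k) us) = length (filter (\<lambda>s. kind s = k) vs)"
  using mset_colour_kind[OF assms, of k] by (metis length_map size_mset)

lemma anagram_rev: "anagram (rev w) \<longleftrightarrow> anagram w"
proof -
  have "anagram (rev w)" if w: "anagram w" for w :: "'c list"
  proof -
    obtain W P where "w = W @ P" "W \<noteq> []" "mset P = mset W" using w unfolding anagram_def by blast
    then have "rev w = rev P @ rev W" "rev P \<noteq> []" "mset (rev W) = mset (rev P)" by auto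
    then show ?thesis unfolding anagram_def by blast
  qed
  from this[of w] this[of "rev w"] show ?thesis by auto
qed

theorem tree_path_not_anagram:
  assumes "distinct p" "successively (\<lambda>s t. child_of s t \<or> child_of t s) p"
  shows "\<not> anagram (map colour p)"
proof
  assume an: "anagram (map colour p)"
  then have "p \<noteq> []" by (auto simp: anagram_def)
  then obtain a xs ys where p: "p = rev xs @ a # ys" "descending (a # xs)" "descending (a # ys)"
    using tree_path_decomp assms by blast
  obtain us vs where uv: "p = us @ vs" "us \<noteq> []" and eq: "mset (map colour us)
    = mset (map colour vs)"
    using an by (rule anagram_mapE)
  have vs: "vs \<noteq> []" using eq uv(2) by auto
  have xs: "xs \<noteq> []" using descending_not_anagram[OF p(3)] an p(1) by auto
  have ys: "ys \<noteq> []"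
    using descending_not_anagram[OF p(2)] an anagram_rev[of "map colour p"] p(1)
      by (auto simp: rev_map)
  have ne: "hd xs \<noteq> hd ys" using assms(1) xs ys unfolding p(1) by (cases xs; cases ys) auto
  \<comment> \<open>The half without \<open>a\<close> lies within one branch, or is
    \<open>rev xs\<close> itself; reversing the path exchanges the two situations.\<close>
  have "(\<exists>ms. us = rev xs @ a # ms \<and> ys = ms @ vs) \<or> (\<exists>ms. rev vs = rev ys @ a # ms \<and> xs = ms
    @ rev us)"
  proof -
    have e: "us @ vs = rev xs @ a # ys" using uv p by simp
    then consider zs where "us = rev xs @ zs" "zs @ vs = a # ys" | zs
      where "us @ zs = rev xs" "vs = zs @ a # ys"
      by (metis append_eq_append_conv2)
    then show ?thesis
    proof cases
      case 1
      show ?thesis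
      proof (cases zs)
        case Nil
        then have "rev vs = rev ys @ a # []" "xs = [] @ rev us" using 1 by auto
        then show ?thesis by blast
      qed (use 1 in auto)
    next
      case 2
      then have "xs = rev zs @ rev us" by (metis rev_append rev_rev_ident)
      then show ?thesis using 2 by auto
    qed
  qed
  then show False
  proof (elim disjE exE conjE)
    fix ms assume "us = rev xs @ a # ms" "ys = ms @ vs"
    then show False
      using branching_kind_counts[of a xs ms vs] p xs vs ne length_filter_kind[OF eq] by auto
  next
    fix ms assume ms: "rev vs = rev ys @ a # ms" "xs = ms @ rev us"
    have "mset (map colour (rev vs)) = mset (map colour (rev us))" using eq by simp
    from length_filter_kind[OF this] show False
      using branching_kind_counts[of a ys ms "rev us"] p ys uv(2) ne ms by (auto simp del: mset_map)
  qed
qed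

lemma colour_less: "colour s < 9"
  using kind_cases[of s] letter_less[of "cnt (kind s) s"] by (auto simp: colour_def)

end

subsection \<open>Addresses of the vertices of a rooted tree\<close>

lemma (in pair_wf_digraph) vwalk_imp_awalk:
  assumes "vwalk p G"
  shows "awalk (hd p) (vwalk_arcs p) (last p) \<and> awalk_verts (hd p) (vwalk_arcs p) = p"
  using assms
proof (induction rule: vwalk_induct)
  case (Base u)
  then show ?case by (simp add: awalk_Nil_iff)
next
  case (Cons u v es)
  then show ?case by (auto simp: awalk_Cons_iff)
qed

lemma (in wf_digraph) vwalk_snoc_iff:
  assumes "p \<noteq> []"
  shows "vwalk (p @ [x]) G \<longleftrightarrow> vwalk p G \<and> (last p, x) \<in> arcs_ends G"
  using assms adj_in_verts(2)[of "last p" x] by (auto simp: vwalk_def set_vwalk_arcs_snoc)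

lemma length_vwalk_arcs: "length (vwalk_arcs p) = length p - 1"
  using vwalk_length_simp[of p] unfolding vwalk_length_def .

lemma length_vwalk_to_vpath: "length (vwalk_to_vpath p) \<le> length p"
proof (induction p rule: vwalk_to_vpath.induct)
  case (2 x xs)
  then show ?case using length_dropWhile_le[of "\<lambda>y. y \<noteq> x" xs] by auto
qed simp

locale rooted_tree =
  fixes T :: "'a pair_pre_digraph" and r :: 'a and d h :: nat
  assumes dary: "dary_tree d T r" and height: "height T r = h"

sublocale rooted_tree \<subseteq> pair_graph T
  using dary by (simp add: dary_tree_def undirected_tree_def)

context rooted_tree
begin

section \<open>Uniqueness of paths from the root\<close>

text \<open>Such an arc would close an undirected cycle; three vertices exclude the trivial cycle
  made of the two arcs of one edge.\<close>

lemma no_chord: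
  assumes "vpath p T" "3 \<le> length p"
  shows "(last p, hd p) \<notin> parcs T"
proof
  assume e: "(last p, hd p) \<in> parcs T"
  have p: "vwalk p T" "distinct p" "p \<noteq> []" using assms by auto
  then have w: "awalk (hd p) (vwalk_arcs p) (last p)" "awalk_verts (hd p) (vwalk_arcs p) = p"
    using vwalk_imp_awalk by auto
  let ?c = "vwalk_arcs p @ [(last p, hd p)]"
  have e': "awalk (last p) [(last p, hd p)] (hd p)"
    using e by (auto simp: awalk_simps dest: in_arcsD1 in_arcsD2)
  with w have "awalk (hd p) ?c (hd p)" by (rule_tac awalk_appendI)
  moreover have "awalk_verts (hd p) ?c = p @ [hd p]"
    using w e' by (simp add: awalk_verts_append)
  moreover have "distinct (tl (p @ [hd p]))" using p by (cases p) auto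
  ultimately have "cycle ?c" unfolding cycle_def by auto
  moreover have "length ?c = length p" using assms(2) by (simp add: length_vwalk_arcs)
  ultimately show False
    using dary assms(2) unfolding dary_tree_def undirected_tree_def by metis
qed

definition root_path :: "'a list \<Rightarrow> 'a \<Rightarrow> bool" where
  "root_path p v \<longleftrightarrow> vpath p T \<and> hd p = r \<and> last p = v"

lemma root_path_snoc:
  assumes "root_path p v" "(v, w) \<in> parcs T" "w \<notin> set p"
  shows "root_path (p @ [w]) w"
proof -
  have "p \<noteq> []" using assms(1) by (auto simp: root_path_def)
  then show ?thesis using assms vwalk_snoc_iff[of p w] by (auto simp: root_path_def vpath_def)
qed

lemma root_path_butlast:
  assumes "root_path (p @ [w, v]) v"
  shows "root_path (p @ [w]) w" "(w, v) \<in> parcs T"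
proof -
  have "vwalk ((p @ [w]) @ [v]) T" using assms by (auto simp: root_path_def)
  then have "vwalk (p @ [w]) T \<and> (w, v) \<in> parcs T" by (subst (asm) vwalk_snoc_iff) auto
  then show "root_path (p @ [w]) w" "(w, v) \<in> parcs T"
    using assms by (auto simp: root_path_def vpath_def hd_append split: if_splits)
qed

text \<open>Otherwise the segment of \<open>p\<close> from \<open>w\<close> to \<open>v\<close>
  would have at least three vertices and a chord.\<close>

lemma root_path_penultimate:
  assumes "root_path p v" "(v, w) \<in> parcs T" "w \<in> set p"
  obtains q where "p = q @ [w, v]"
proof -
  obtain q s where p: "p = q @ w # s" using assms(3) by (meson split_list)
  have "v \<noteq> w" using assms(2) no_loops' by blast
  moreover have last: "last p = v" using assms(1) by (simp add: root_path_def)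
  ultimately have s: "s \<noteq> []" "last s = v" using p by auto
  have "vpath (w # s) T"
    using assms(1) vwalkI_append_r[of "w # s" q T] by (auto simp: root_path_def vpath_def p)
  then have "\<not> 3 \<le> length (w # s)" using no_chord[of "w # s"] assms(2) s by auto
  then have "s = [v]" using s by (cases s; cases "tl s") auto
  then show thesis using p that by simp
qed

text \<open>Let \<open>w\<close> precede \<open>v\<close> on the second path. If \<open>w\<close> is
  on \<open>p\<close>, it precedes \<open>v\<close> there too. If not, \<open>p\<close> extended by
  \<open>w\<close> is the root path to \<open>w\<close>, and \<open>v\<close> occurs twice on the
  second path.\<close>

lemma root_path_unique:
  assumes "root_path p v" "root_path q v"
  shows "p = q"
  using assms
proof (induction q arbitrary: p v rule: rev_induct)
  case Nil
  then show ?case by (auto simp: root_path_def)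
next
  case (snoc v' q)
  then have v': "v' = v" by (simp add: root_path_def)
  show ?case
  proof (cases q rule: rev_cases)
    case Nil
    then have "v = r" using snoc.prems(2) v' by (simp add: root_path_def)
    moreover obtain s where "p = r # s" "distinct p" "last p = v"
      using snoc.prems(1) by (cases p) (auto simp: root_path_def)
    ultimately have "p = [r]" by (cases s rule: rev_cases) auto
    then show ?thesis using Nil v' \<open>v = r\<close> by simp
  next
    case (snoc q' w)
    then have rq: "root_path (q' @ [w, v]) v" using snoc.prems(2) v' by simp
    note q = root_path_butlast[OF rq]
    have vw: "(v, w) \<in> parcs T" by (rule arcs_symmetric[OF q(2)])
    show ?thesis
    proof (cases "w \<in> set p")
      case True
      then obtain s where s: "p = s @ [w, v]"
        using root_path_penultimate[OF snoc.prems(1) vw] by blast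
      then have "root_path (s @ [w]) w" using root_path_butlast snoc.prems(1) by blast
      then have "s @ [w] = q" using snoc.IH[of "s @ [w]" w] q(1) snoc by simp
      then show ?thesis using s snoc v' by simp
    next
      case False
      then have "root_path (p @ [w]) w" using root_path_snoc[OF snoc.prems(1) vw] by blast
      then have "p @ [w] = q" using snoc.IH[of "p @ [w]" w] q(1) snoc by simp
      moreover have "v \<in> set p" using snoc.prems(1)
        by (auto simp: root_path_def vpath_def vwalk_def)
      ultimately have "v \<in> set q" by auto
      then show ?thesis using snoc.prems(2) v' by (auto simp: root_path_def)
    qed
  qed
qed

lemma root_in: "r \<in> pverts T"
  using dary by (simp add: dary_tree_def)

lemma vwalk_from_root:
  assumes "v \<in> pverts T"
  obtains p where "vwalk p T" "hd p = r" "last p = v"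
proof -
  have "connected (with_proj T)" using dary by (simp add: dary_tree_def undirected_tree_def)
  then have "r \<rightarrow>\<^sup>*\<^bsub>mk_symmetric T\<^esub> v"
    using assms root_in by (auto simp: connected_def strongly_connected_def)
  then have "r \<rightarrow>\<^sup>*\<^bsub>T\<^esub> v" by (subst (asm) reachable_mk_symmetric_eq) (rule pair_sym_arcs)
  then obtain p where p: "awalk r p v" by (auto simp: reachable_awalk)
  show thesis
  proof (rule that)
    show "vwalk (awalk_verts r p) T" by (rule awalk_imp_vwalk[OF p])
    show "hd (awalk_verts r p) = r" "last (awalk_verts r p) = v" using p by auto
  qed
qed

definition path_to :: "'a \<Rightarrow> 'a list" where
  "path_to v = (THE p. root_path p v)"

lemma path_to_eq: "root_path p v \<Longrightarrow> path_to v = p"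
  unfolding path_to_def using root_path_unique by blast

lemma root_path_path_to:
  assumes "v \<in> pverts T"
  shows "root_path (path_to v) v"
proof -
  obtain p where "vwalk p T" "hd p = r" "last p = v" using vwalk_from_root[OF assms] .
  then have "\<exists>q. root_path q v" using vwalk_imp_ex_vpath unfolding root_path_def by metis
  then show ?thesis using path_to_eq by metis
qed

lemma path_to_arc:
  assumes "(u, v) \<in> parcs T"
  shows "path_to v = path_to u @ [v] \<or> path_to u = path_to v @ [u]"
proof (cases "v \<in> set (path_to u)")
  case True
  have u: "root_path (path_to u) u" using root_path_path_to in_arcsD1[OF assms] .
  then obtain q where q: "path_to u = q @ [v, u]"
    using root_path_penultimate[OF _ assms True] by blast
  then have "root_path (q @ [v]) v" using root_path_butlast(1)[of q v u] u by simp
  then have "path_to v = q @ [v]" by (rule path_to_eq)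
  then show ?thesis using q by simp
next
  case False
  then show ?thesis using root_path_snoc[OF root_path_path_to assms] in_arcsD1[OF assms]
    path_to_eq by blast
qed

text \<open>A shortest walk from the root, shortened to a path, is the root path by
  uniqueness.\<close>

lemma length_path_to:
  assumes "v \<in> pverts T"
  shows "length (path_to v) \<le> Suc h"
proof -
  have "\<exists>n p. vwalk p (with_proj T) \<and> hd p = r \<and> last p = v \<and> vwalk_length p = n"
    using vwalk_from_root[OF assms] by metis
  then have "\<exists>p. vwalk p (with_proj T) \<and> hd p = r \<and> last p = v \<and> vwalk_length p = distance T r v"
    unfolding distance_def by (rule LeastI_ex)
  then obtain p where p: "vwalk p T" "hd p = r" "last p = v" "length p - 1 = distance T r v"
    by auto
  have "distance T r v \<le> h"
    unfolding height[symmetric] height_def using assms pair_finite_verts by (intro Max_ge) auto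
  moreover have "root_path (vwalk_to_vpath p) v"
    using p vwalk_to_vpath_vpath vwalk_to_vpath_hd vwalk_to_vpath_last by (auto simp: root_path_def)
  then have "path_to v = vwalk_to_vpath p" by (rule path_to_eq)
  ultimately show ?thesis using p(4) length_vwalk_to_vpath[of p] by simp
qed

lemma path_to_last:
  assumes "v \<in> pverts T"
  obtains q where "path_to v = q @ [v]"
  using root_path_path_to[OF assms] that
    by (cases "path_to v" rule: rev_cases) (auto simp: root_path_def)

lemma child_of_path:
  assumes "v \<in> pverts T" "w \<in> pverts T" "path_to w = path_to v @ [w]"
  shows "w \<in> children T r v"
proof -
  obtain q where "path_to v = q @ [v]" using path_to_last[OF assms(1)] .
  then have "root_path (q @ [v, w]) w" using root_path_path_to[OF assms(2)] assms(3) by simp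
  then show ?thesis unfolding children_def root_path_def by blast
qed

section \<open>Numbering children and addressing vertices\<close>

lemma finite_children: "finite (children T r v)"
proof (rule finite_subset)
  show "children T r v \<subseteq> pverts T" by (auto simp: children_def vpath_def vwalk_def)
qed (rule pair_finite_verts)

lemma ex_child_index:
  "\<exists>idx. \<forall>v \<in> pverts T. inj_on (idx v) (children T r v) \<and> idx v ` children T r v \<subseteq> {1..d}"
proof (rule bchoice, rule ballI)
  fix v assume "v \<in> pverts T"
  then have "card (children T r v) \<le> card {1..d}" using dary by (simp add: dary_tree_def)
  then show "\<exists>f. inj_on f (children T r v) \<and> f ` children T r v \<subseteq> {1..d}"
    using inj_on_iff_card_le[OF finite_children, of "{1..d}"] by simp
qed

text \<open>An address lists child numbers from \<open>v\<close> up to the root. Its tail is the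
  address of the parent and its head separates siblings, so induction on the length gives
  injectivity.\<close>

lemma ex_code:
  obtains code :: "'a \<Rightarrow> nat list" where "inj_on code (pverts T)"
    "\<And>v. v \<in> pverts T \<Longrightarrow> length (code v) \<le> h \<and> set (code v) \<subseteq> {1..d}"
    "\<And>u v. (u, v) \<in> parcs T \<Longrightarrow> (\<exists>j. code v = j # code u) \<or> (\<exists>j. code u = j # code v)"
proof -
  obtain idx where idx: "\<And>v. v \<in> pverts T \<Longrightarrow> inj_on (idx v) (children T r v)"
    "\<And>v. v \<in> pverts T \<Longrightarrow> idx v ` children T r v \<subseteq> {1..d}"
    using ex_child_index by metis
  define code where "code v = rev (map (\<lambda>(x, y). idx x y) (vwalk_arcs (path_to v)))" for v
  have code_snoc: "code w = idx v w # code v"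
    if v: "v \<in> pverts T" and w: "path_to w = path_to v @ [w]" for v w
  proof -
    obtain q where "path_to v = q @ [v]" using path_to_last[OF v] .
    then show ?thesis using w vwalk_arcs_append[of "path_to v" "[w]"] by (simp add: code_def)
  qed
  have parent: "v = r \<and> code v = [] \<or> (\<exists>u \<in> pverts T. path_to v = path_to u @ [v])" if v:
    "v \<in> pverts T" for v
  proof -
    obtain q where q: "path_to v = q @ [v]" using path_to_last[OF v] .
    have rv: "root_path (path_to v) v" by (rule root_path_path_to[OF v])
    show ?thesis
    proof (cases q rule: rev_cases)
      case Nil
      then show ?thesis using q rv by (simp add: root_path_def code_def)
    next
      case (snoc q' u)
      then have ru: "root_path (q' @ [u]) u" using root_path_butlast[of q' u v] rv q by simp
      then have "path_to v = path_to u @ [v]" using path_to_eq q snoc by simp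
      moreover have "u \<in> pverts T" using ru by (auto simp: root_path_def vpath_def vwalk_def)
      ultimately show ?thesis by blast
    qed
  qed
  have root: "v = r" if "v \<in> pverts T" "code v = []" for v
    using parent[OF that(1)] code_snoc that(2) by (metis list.distinct(1))
  have "v = w" if "v \<in> pverts T" "w \<in> pverts T" "code v = code w" for v w
    using that
  proof (induction "length (code v)" arbitrary: v w)
    case 0
    then show ?case using root[of v] root[of w] by simp
  next
    case (Suc n)
    then obtain v' w' where v': "v' \<in> pverts T" "path_to v = path_to v' @ [v]"
      and w': "w' \<in> pverts T" "path_to w = path_to w' @ [w]"
      using parent[of v] parent[of w] by fastforce
    have e: "idx v' v = idx w' w" "code v' = code w'" "n = length (code v')"
      using code_snoc[OF v'] code_snoc[OF w'] Suc.prems(3) Suc.hyps(2) by auto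
    then have "v' = w'" using Suc.hyps(1) v'(1) w'(1) by blast
    then show ?case
      using e(1) idx(1)[OF v'(1)] child_of_path[OF v'(1) Suc.prems(1) v'(2)]
        child_of_path[OF w'(1) Suc.prems(2) w'(2)] by (auto dest: inj_onD)
  qed
  then have "inj_on code (pverts T)" by (rule inj_onI)
  moreover have "length (code v) \<le> h \<and> set (code v) \<subseteq> {1..d}" if v: "v \<in> pverts T" for v
  proof
    show "length (code v) \<le> h"
      using length_path_to[OF v] by (simp add: code_def length_vwalk_arcs)
    show "set (code v) \<subseteq> {1..d}"
      using v
    proof (induction "length (code v)" arbitrary: v)
      case (Suc n)
      then obtain u where u: "u \<in> pverts T" "path_to v = path_to u @ [v]"
        using parent[of v] by fastforce
      have "idx u v \<in> {1..d}" using idx(2)[OF u(1)] child_of_path[OF u(1) Suc.prems u(2)] by blast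
      then show ?case using code_snoc[OF u] Suc.hyps(1)[of u] Suc.hyps(2) u(1) by simp
    qed simp
  qed
  moreover have "(\<exists>j. code v = j # code u) \<or> (\<exists>j. code u = j # code v)" if "(u, v) \<in> parcs T"
    for u v
    using path_to_arc[OF that] code_snoc in_arcsD1[OF that] in_arcsD2[OF that] by blast
  ultimately show thesis using that by blast
qed

end

subsection \<open>The subdivision\<close>

lemma vwalk_arcs_map: "vwalk_arcs (map f p) = map (map_prod f f) (vwalk_arcs p)"
  by (induction p rule: vwalk_arcs.induct) auto

lemma successively_vwalk_arcs: "successively R p \<longleftrightarrow> (\<forall>(x, y) \<in> set (vwalk_arcs p). R x y)"
  by (induction p rule: vwalk_arcs.induct) auto

context address
begin

definition branch :: "nat list \<Rightarrow> (nat list \<times> nat) list" where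
  "branch c = (tl c, 0) # map (Pair c) (rev [0..<Suc (2 * half c)])"

lemma branch_eq: "branch c = (tl c, 0) # map (Pair c) (rev [1..<Suc (2 * half c)]) @ [(c, 0)]"
  by (simp add: branch_def upt_conv_Cons del: upt_Suc)

lemma distinct_branch: "c \<noteq> [] \<Longrightarrow> distinct (branch c)"
  unfolding branch_def by (cases c) (auto simp: distinct_map inj_on_def simp del: upt_Suc
    half.simps)

lemma descending_branch_list:
  assumes "c \<noteq> []" "length c \<le> h" "set c \<subseteq> {1..d}"
  shows "descending (branch c)"
proof -
  have "descending (map (Pair c) (rev [0..<Suc m]))" if "m \<le> 2 * half c" for m
    using that
  proof (induction m)
    case (Suc m)
    then have "child_of (c, Suc m) (c, m)" using assms by (simp add: child_of_def valid_def)
    then show ?case using Suc by simp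
  qed simp
  moreover have "child_of (tl c, 0) (c, 2 * half c)" using assms
    by (simp add: child_of_def valid_def)
  ultimately show ?thesis unfolding branch_def by simp
qed

lemma inner_branch: "inner_vertices (map f (branch c))
  = map f (map (Pair c) (rev [1..<Suc (2 * half c)]))"
  unfolding branch_eq inner_vertices_def by (simp add: butlast_append del: upt_Suc)

lemma inner_rev: "inner_vertices (rev p) = rev (inner_vertices p)"
  unfolding inner_vertices_def by (metis butlast_rev butlast_tl rev_rev_ident tl_rev)

text \<open>The extreme case is the \<open>d\<close>-th child of the root; twice this value bounds
  the division vertices of an edge.\<close>

lemma half_bound:
  assumes "length c \<le> h" "set c \<subseteq> {1..d}"
  shows "half c \<le> d * (d + 1) ^ (h - 1)"
proof (cases c)
  case (Cons j c')
  then have "j \<le> d" using assms by simp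
  moreover have "(d + 1) ^ (h - Suc (length c')) \<le> (d + 1) ^ (h - 1)"
    by (intro power_increasing) auto
  ultimately show ?thesis unfolding Cons half.simps by (rule mult_le_mono)
qed simp

lemma ex_subdivision:
  fixes T :: "'a pair_pre_digraph" and code :: "'a \<Rightarrow> nat list"
  assumes T: "pair_graph T" and inj: "inj_on code (pverts T)"
    and code: "\<And>v. v \<in> pverts T \<Longrightarrow> length (code v) \<le> h \<and> set (code v) \<subseteq> {1..d}"
    and arc: "\<And>u v. (u, v) \<in> parcs T \<Longrightarrow> (\<exists>j. code v = j # code u) \<or> (\<exists>j. code u = j # code v)"
  shows "\<exists>S :: nat pair_pre_digraph. le_subdivision (2 * d * (d + 1) ^ (h - 1)) T S \<and> \<phi> S \<le> 10"
proof -
  interpret T: pair_graph T by (rule T)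
  \<comment> \<open>Addresses are countable, so the vertices of \<open>S\<close> can be natural
    numbers.\<close>
  define enc :: "nat list \<times> nat \<Rightarrow> nat" where "enc = to_nat"
  define dec :: "nat \<Rightarrow> nat list \<times> nat" where "dec = from_nat"
  have dec: "dec (enc s) = s" for s by (simp add: enc_def dec_def)
  then have enc: "inj enc" by (metis injI)
  define f where "f v = enc (code v, 0)" for v
  define child where "child u v \<longleftrightarrow> (\<exists>j. code v = j # code u)" for u v
  have child_tl: "code v \<noteq> []" "tl (code v) = code u" if "child u v" for u v
    using that by (auto simp: child_def)
  have child_asym: "\<not> child v u" if "child u v" for u v
  proof
    assume "child v u"
    with that have "length (code v) = Suc (length (code u))" "length (code u)
      = Suc (length (code v))"
      unfolding child_def by (metis length_Cons)+
    then show False by simp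
  qed
  have child: "child u v \<or> child v u" if "(u, v) \<in> parcs T" for u v
    using arc[OF that] unfolding child_def .
  \<comment> \<open>The address of the lower end is shared by both arcs of an edge, and its tail is
    the address of the upper end; so it determines the edge.\<close>
  define low where "low = (\<lambda>(u, v). if child u v then code v else code u)"
  define P where "P = (\<lambda>(u, v). if child u v then map enc (branch (code v))
    else rev (map enc (branch (code u))))"
  define S where "S = \<lparr> pverts = f ` pverts T \<union> (\<Union>e \<in> parcs T. set (inner_vertices (P e))),
    parcs = (\<Union>e \<in> parcs T. set (vwalk_arcs (P e))) \<rparr>"
  have low: "low e \<noteq> []" "length (low e) \<le> h" "set (low e) \<subseteq> {1..d}" if "e \<in> parcs T" for e
  proof -
    obtain u v where e: "e = (u, v)" by fastforce
    then have "u \<in> pverts T" "v \<in> pverts T" using that T.in_arcsD1 T.in_arcsD2 by blast+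
    then show "low e \<noteq> []" "length (low e) \<le> h" "set (low e) \<subseteq> {1..d}"
      using code child[of u v] child_tl that by (auto simp: e low_def)
  qed
  have P_low: "P e = map enc (branch (low e)) \<or> P e = rev (map enc (branch (low e)))" for e
    by (auto simp: P_def low_def split: prod.split)
  have inner: "set (inner_vertices (P e)) = enc ` Pair (low e) ` {1..2 * half (low e)}"
    "length (inner_vertices (P e)) = 2 * half (low e)" for e
    using P_low[of e] by (auto simp: inner_rev inner_branch atLeastLessThanSuc_atLeastAtMost simp
      del: upt_Suc)
  have P_rev: "P (v, u) = rev (P (u, v))" if "(u, v) \<in> parcs T" for u v
    using child[OF that] child_asym by (auto simp: P_def)
  have ends: "hd (P (u, v)) = f u" "last (P (u, v)) = f v" if "(u, v) \<in> parcs T" for u v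
    using child[OF that] child_asym child_tl
      by (auto simp: P_def f_def branch_eq hd_rev last_rev simp del: upt_Suc)
  have set_P: "set (P e) = {f (fst e), f (snd e)} \<union> set (inner_vertices (P e))"
    if "e \<in> parcs T" for e
  proof -
    have ne: "P e \<noteq> []" "tl (P e) \<noteq> []" using P_low[of e]
      by (auto simp: branch_eq simp del: upt_Suc)
    then have "P e = hd (P e) # inner_vertices (P e) @ [last (P e)]"
      unfolding inner_vertices_def by (metis append_butlast_last_id hd_Cons_tl last_tl)
    then have "set (P e) = insert (hd (P e)) (insert (last (P e)) (set (inner_vertices (P e))))"
      by (metis Un_insert_right list.simps(15) set_append sup_bot.right_neutral list.set(1))
    then show ?thesis using ends[of "fst e" "snd e"] that by simp
  qed
  have distinct_P: "distinct (P e)" if "e \<in> parcs T" for e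
    using P_low[of e] distinct_branch[OF low(1)[OF that]] enc
    by (auto simp: distinct_map inj_on_subset[OF enc])
  have steps: "\<exists>s t. x = enc s \<and> y = enc t \<and> (child_of s t \<or> child_of t s)" if xy:
    "(x, y) \<in> parcs S" for x y
  proof -
    obtain e where e: "e \<in> parcs T" "(x, y) \<in> set (vwalk_arcs (P e))" using xy by (auto simp: S_def)
    have "(x, y) \<in> set (vwalk_arcs (map enc (branch (low e))))
      \<or> (y, x) \<in> set (vwalk_arcs (map enc (branch (low e))))"
      using P_low[of e] e(2) by (auto simp: set_vwalk_arcs_rev)
    then show ?thesis
      using descending_branch_list[OF low[OF e(1)]]
      unfolding successively_vwalk_arcs vwalk_arcs_map by fastforce
  qed
  have verts_S: "pverts S \<subseteq> range enc" by (auto simp: S_def f_def inner)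
  have set_P_S: "set (P e) \<subseteq> pverts S" if "e \<in> parcs T" for e
    unfolding set_P[OF that] using that T.arc_fst_in_verts T.arc_snd_in_verts by (auto simp: S_def)
  have S: "pair_graph S"
  proof
    fix e assume "e \<in> parcs S"
    then obtain e' where e': "e' \<in> parcs T" "e \<in> set (vwalk_arcs (P e'))" by (auto simp: S_def)
    then have "e \<in> set (P e') \<times> set (P e')" by (blast dest: arcs_in_vwalk_arcs)
    then show "fst e \<in> pverts S" "snd e \<in> pverts S" using set_P_S[OF e'(1)] by auto
    obtain s t where "e = (enc s, enc t)" "child_of s t \<or> child_of t s"
      using steps[of "fst e" "snd e"] \<open>e \<in> parcs S\<close> by (metis prod.collapse)
    moreover have "s \<noteq> t" if "child_of s t" for s t
      using that half_pos[of t] by (cases t) (auto simp: child_of_def split: if_splits)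
    ultimately have "e = (enc s, enc t)" "s \<noteq> t" by metis+
    then show "fst e \<noteq> snd e" by (simp add: inj_eq[OF enc])
  next
    show "finite (pverts S)" using T.pair_finite_verts T.pair_finite_arcs by (simp add: S_def)
    show "finite (parcs S)" using T.pair_finite_arcs by (simp add: S_def)
    show "symmetric S"
      unfolding symmetric_def
    proof (rule symI)
      fix x y assume "(x, y) \<in> arcs_ends S"
      then obtain u v where uv: "(u, v) \<in> parcs T" "(x, y) \<in> set (vwalk_arcs (P (u, v)))"
        by (auto simp: S_def)
      then have "(y, x) \<in> set (vwalk_arcs (P (v, u)))"
        unfolding P_rev[OF uv(1)] set_vwalk_arcs_rev by simp
      then show "(y, x) \<in> arcs_ends S" using T.arcs_symmetric[OF uv(1)] by (auto simp: S_def)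
    qed
  qed
  have "le_subdivision (2 * d * (d + 1) ^ (h - 1)) T S"
    unfolding le_subdivision_def
  proof (intro conjI exI[of _ f] exI[of _ P])
    show "inj_on f (pverts T)" using inj enc by (auto simp: inj_on_def f_def)
    show "\<forall>(u, v) \<in> parcs T. vpath (P (u, v)) (with_proj S) \<and> hd (P (u, v)) = f u
      \<and> last (P (u, v)) = f v \<and>
        P (v, u) = rev (P (u, v)) \<and> set (inner_vertices (P (u, v))) \<inter> f ` pverts T = {} \<and>
        length (inner_vertices (P (u, v))) \<le> 2 * d * (d + 1) ^ (h - 1)"
    proof clarify
      fix u v assume uv: "(u, v) \<in> parcs T"
      have "P (u, v) \<noteq> []" using P_low[of "(u, v)"] by (auto simp: branch_def)
      then have "vpath (P (u, v)) (with_proj S)"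
        using set_P_S[OF uv] distinct_P[OF uv] uv by (intro vpathI vwalkI) (auto simp: S_def)
      moreover have "set (inner_vertices (P (u, v))) \<inter> f ` pverts T = {}"
        using enc by (auto simp: inner f_def dest: injD)
      moreover have "length (inner_vertices (P (u, v))) \<le> 2 * d * (d + 1) ^ (h - 1)"
        using half_bound[OF low(2,3)[OF uv]] by (simp add: inner)
      ultimately show "vpath (P (u, v)) (with_proj S) \<and> hd (P (u, v)) = f u \<and> last (P (u, v))
        = f v \<and>
        P (v, u) = rev (P (u, v)) \<and> set (inner_vertices (P (u, v))) \<inter> f ` pverts T = {} \<and>
        length (inner_vertices (P (u, v))) \<le> 2 * d * (d + 1) ^ (h - 1)"
        using ends[OF uv] P_rev[OF uv] by blast
    qed
    show "\<forall>e \<in> parcs T. \<forall>e' \<in> parcs T. e' \<noteq> e \<and> e' \<noteq> prod.swap e \<longrightarrow>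
        set (inner_vertices (P e)) \<inter> set (inner_vertices (P e')) = {}"
    proof (intro ballI impI)
      fix e e' assume e: "e \<in> parcs T" "e' \<in> parcs T" "e' \<noteq> e \<and> e' \<noteq> prod.swap e"
      obtain u v u' v' where uv: "e = (u, v)" "e' = (u', v')" by fastforce
      have V: "u \<in> pverts T" "v \<in> pverts T" "u' \<in> pverts T" "v' \<in> pverts T"
        using e(1,2) unfolding uv by (blast dest: T.in_arcsD1 T.in_arcsD2)+
      have "low e \<noteq> low e'"
      proof
        assume "low e = low e'"
        moreover have "{code u, code v} = {low (u, v), tl (low (u, v))}" if "(u, v) \<in> parcs T"
          for u v
          using child[OF that] child_tl by (auto simp: low_def)
        ultimately have "{code u, code v} = {code u', code v'}" using e(1,2) unfolding uv by metis
        then show False using e(3) V inj unfolding uv by (auto simp: doubleton_eq_iff dest: inj_onD)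
      qed
      then show "set (inner_vertices (P e)) \<inter> set (inner_vertices (P e')) = {}"
        using enc by (auto simp: inner dest: injD)
    qed
  qed (use T S in \<open>simp_all add: S_def\<close>)
  moreover have "\<phi> S \<le> 10"
    unfolding anagram_free_chromatic_number_def
  \<comment> \<open>A single colouring suffices for the upper bound; \<open>colour\<close> takes
    values below 9.\<close>
  proof (rule Least_le, intro exI conjI)
    show "(\<lambda>x. colour (dec x)) ` pverts S \<subseteq> {..<10}"
    proof clarify
      fix x
      show "colour (dec x) < 10" using colour_less[of "dec x"] by linarith
    qed
    show "anagram_free_colouring (\<lambda>x. colour (dec x)) S"
      unfolding anagram_free_colouring_def
    proof (intro allI impI)
      fix p assume p: "vpath p (with_proj S)"
      have "enc (dec x) = x" if "x \<in> pverts S" for x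
        using that verts_S dec by (metis rangeE subsetD)
      then have "inj_on dec (pverts S)" by (metis inj_onI)
      then have distinct: "distinct (map dec p)"
        using p by (auto simp: vpath_def vwalk_def distinct_map intro: inj_on_subset)
      have "set (vwalk_arcs p) \<subseteq> parcs S" using p by (auto simp: vpath_def vwalk_def)
      moreover have "child_of (dec x) (dec y) \<or> child_of (dec y) (dec x)"
        if "(x, y) \<in> parcs S" for x y
        using steps[OF that] dec by auto
      ultimately have "successively (\<lambda>s t. child_of s t \<or> child_of t s) (map dec p)"
        unfolding successively_map unfolding successively_vwalk_arcs by blast
      with distinct have "\<not> anagram (map colour (map dec p))" by (rule tree_path_not_anagram)
      then show "\<not> anagram (map (\<lambda>x. colour (dec x)) p)" by (simp add: o_def)
    qed
  qed
  ultimately show ?thesis by blast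
qed

end

theorem theorem3:
  fixes T :: "'a pair_pre_digraph" and r :: 'a and d h :: nat
  assumes "d \<ge> 1" and "h \<ge> 1"
    and "dary_tree d T r" and "height T r = h"
  shows "\<exists>S :: nat pair_pre_digraph.
    le_subdivision (2 * d * (d + 1) ^ (h - 1)) T S \<and> \<phi> S \<le> 10"
proof -
  interpret rooted_tree T r d h using assms(3,4) by unfold_locales
  show ?thesis
  proof (rule ex_code)
    fix code :: "'a \<Rightarrow> nat list"
    assume "inj_on code (pverts T)"
      "\<And>v. v \<in> pverts T \<Longrightarrow> length (code v) \<le> h \<and> set (code v) \<subseteq> {1..d}"
      "\<And>u v. (u, v) \<in> parcs T \<Longrightarrow> (\<exists>j. code v = j # code u) \<or> (\<exists>j. code u = j # code v)"
    with pair_graph show ?thesis by (rule address.ex_subdivision)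
  qed
qed

end
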